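(* For each of the following descriptions there exist finitely many homeomorphisms $f_1,\dots,f_n:S^1\to S^1$, each with rotation number $0$, and a minimal set $M\subset S^1$ for $IFS(f_1,\dots,f_n)$ whose canonical decomposition $M=\mathcal{I}\cup K\cup N$ (see context) fits the description: (i) $M$ is finite; (ii) $M$ is a Cantor set; (iii) $M=S^1$; (iv) $\mathcal I$, $K$ and $N$ are all nonempty and $\partial\mathcal{I}\cap N\neq\emptyset$; (v) $M=\mathcal{I}\cup N$ with $\mathcal I\neq\emptyset$, $N\neq\emptyset$ and $K=\emptyset$; (vi) $M=\mathcal{I}\cup K$ with $\mathcal I\neq\emptyset$, $K\neq\emptyset$ and $N=\emptyset$.
   Context: $IFS(f_1,\dots,f_n)$ is the set of all finite compositions (finite words) of the maps $f_1,\dots,f_n$. The orbit of $x$ is $O(x)=\{\phi(x):\phi\in IFS(f_1,\dots,f_n)\}$. A set $M$ is invariant if $f_i(M)\subset M$ for every $i$. A nonempty set $M$ is minimal for the IFS if it is closed, invariant, and $\overline{O(x)}=M$ for every $x\in M$. A Cantor set is a nonempty compact, perfect, totally disconnected set. Canonical decomposition: every closed set $M\subset S^1$ is written uniquely as a disjoint union $M=\mathcal{I}\cup K\cup N$, where $\mathcal{I}$ is the union of the connected components of $\mathrm{int}(M)$ (so $\mathcal I=\mathrm{int}(M)$), $K$ is the maximal (with respect to inclusion) Cantor set contained in $M\setminus\mathcal{I}$, with $K=\emptyset$ if there is none, and $N=M\setminus(\mathcal I\cup K)$, which is a countable (possibly finite or empty) set. $\partial\mathcal{I}$ is the topological boundary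 of $\mathcal{I}$ in $S^1$. *)

theory Defs
  imports "HOL-Analysis.Analysis"
begin

abbreviation circle :: "complex topology" where
  "circle \<equiv> top_of_set (sphere 0 1)"

text \<open>An orientation-preserving circle homeomorphism is given by a function on the complex
  plane whose values off the unit circle are irrelevant. Lifts are taken along
  \<open>x \<mapsto> exp (2 \<pi> \<i> x)\<close>, so that the circle is \<open>\<real> / \<int>\<close>.\<close>

definition circle_lift :: "(real \<Rightarrow> real) \<Rightarrow> (complex \<Rightarrow> complex) \<Rightarrow> bool" where
  "circle_lift F f \<longleftrightarrow>
     continuous_on UNIV F \<and> strict_mono F \<and> (\<forall>x. F (x + 1) = F x + 1) \<and>
     (\<forall>x. f (cis (2 * pi * x)) = cis (2 * pi * F x))"

text \<open>The rotation number is a class in \<open>\<real> / \<int>\<close>, whence the comparison modulo integers;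
  changing the lift changes the limit by an integer.\<close>

definition has_rotation_number :: "(complex \<Rightarrow> complex) \<Rightarrow> real \<Rightarrow> bool" where
  "has_rotation_number f \<rho> \<longleftrightarrow>
     (\<exists>F \<tau>. circle_lift F f \<and> (\<forall>x. (\<lambda>n. (F ^^ n) x / real n) \<longlonglongrightarrow> \<tau>) \<and> \<rho> - \<tau> \<in> \<int>)"

text \<open>Words are finite lists of generators. The empty word is allowed; for an invariant set
  and at least one generator this does not affect minimality.\<close>

definition IFS :: "(complex \<Rightarrow> complex) list \<Rightarrow> (complex \<Rightarrow> complex) set" where
  "IFS fs = {foldr (\<circ>) w id | w. set w \<subseteq> set fs}"

definition orbit :: "(complex \<Rightarrow> complex) list \<Rightarrow> complex \<Rightarrow> complex set" where
  "orbit fs x = {\<phi> x | \<phi>. \<phi> \<in> IFS fs}"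

definition invariant_set :: "(complex \<Rightarrow> complex) list \<Rightarrow> complex set \<Rightarrow> bool" where
  "invariant_set fs M \<longleftrightarrow> (\<forall>f \<in> set fs. f ` M \<subseteq> M)"

definition minimal_set :: "(complex \<Rightarrow> complex) list \<Rightarrow> complex set \<Rightarrow> bool" where
  "minimal_set fs M \<longleftrightarrow>
     M \<noteq> {} \<and> closedin circle M \<and> invariant_set fs M \<and>
     (\<forall>x \<in> M. circle closure_of (orbit fs x) = M)"

definition totally_disconnected :: "'a::topological_space set \<Rightarrow> bool" where
  "totally_disconnected C \<longleftrightarrow> (\<forall>x \<in> C. connected_component_set C x = {x})"

definition perfect_set :: "'a::topological_space set \<Rightarrow> bool" where
  "perfect_set C \<longleftrightarrow> closed C \<and> (\<forall>x \<in> C. x islimpt C)"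

definition cantor_set :: "'a::topological_space set \<Rightarrow> bool" where
  "cantor_set C \<longleftrightarrow> C \<noteq> {} \<and> compact C \<and> perfect_set C \<and> totally_disconnected C"

definition maximal_cantor_subset :: "'a::topological_space set \<Rightarrow> 'a set \<Rightarrow> bool" where
  "maximal_cantor_subset K A \<longleftrightarrow>
     cantor_set K \<and> K \<subseteq> A \<and> (\<forall>C. cantor_set C \<and> C \<subseteq> A \<and> K \<subseteq> C \<longrightarrow> C = K)"

definition canonical_decomposition ::
  "complex set \<Rightarrow> complex set \<Rightarrow> complex set \<Rightarrow> complex set \<Rightarrow> bool" where
  "canonical_decomposition M I K N \<longleftrightarrow>
     closedin circle M \<and>
     I = \<Union> (components (circle interior_of M)) \<and>
     (if \<exists>C. cantor_set C \<and> C \<subseteq> M - I then maximal_cantor_subset K (M - I) else K = {}) \<and>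
     N = M - (I \<union> K)"

definition realized_as_minimal_set ::
  "(complex set \<Rightarrow> complex set \<Rightarrow> complex set \<Rightarrow> complex set \<Rightarrow> bool) \<Rightarrow> bool" where
  "realized_as_minimal_set P \<longleftrightarrow>
     (\<exists>fs M I K N. fs \<noteq> [] \<and>
        (\<forall>f \<in> set fs. homeomorphic_map circle circle f \<and> has_rotation_number f 0) \<and>
        minimal_set fs M \<and> canonical_decomposition M I K N \<and> P M I K N)"

end

theory Submission
  imports Defs "HOL-Library.Real_Mod"
begin

text \<open>All examples are made from strictly increasing continuous maps of \<open>[0, 1]\<close> into itself, with
  \<open>[0, 1]\<close> identified with a closed half circle. Such a map has a fixed point, and it extends to a
  homeomorphism of the circle because its image leaves room for the complementary half circle;
  the fixed point forces rotation number zero (\<open>circle_homeomorphism_of_arc_map\<close>). A nonempty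
  closed invariant set
  \<open>M\<close> is minimal as soon as every nonempty closed invariant subset contains \<open>M\<close> (\<open>minimal_setI\<close>), and for
  contractions this follows by approximation (\<open>contraction_approximation\<close>).

  A single point and the identity give a finite minimal set. The halving maps \<open>x / 2\<close> and
  \<open>(x + 1) / 2\<close> make \<open>[0, 1]\<close> minimal, which is an interval with two extra endpoints; imposing them on
  both half circles makes the whole circle minimal, because the half circles overlap in their
  endpoints. The three maps \<open>(x + d) / 5\<close> with \<open>d = 0, 2, 4\<close> have a Cantor set as attractor.

  For the two mixed descriptions, an interval \<open>[a, b] \<subseteq> [1/5, 2/5]\<close> is inserted into one of the two
  gaps of this Cantor set, together with all its images under the three contractions, while the
  other gap \<open>(3/5, 4/5)\<close> and all its images stay empty. Two additional generators, each the
  identity on one side of \<open>[a, b]\<close>, collect all other points in \<open>[a, b]\<close> and halve that interval, so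
  that every nonempty closed invariant subset contains \<open>[a, b]\<close> and then the closure of its images
  (\<open>realized_filled_cantor\<close>). The empty gaps keep the Cantor set out of the interior. If
  \<open>[a, b]\<close> lies strictly inside its gap, the ends of the inserted intervals are isolated in the
  frontier and form \<open>N\<close>; if \<open>[a, b]\<close> is the full closed gap, these ends belong to the Cantor set and
  \<open>N\<close> is empty.\<close>

section \<open>Circle homeomorphisms with a fixed point\<close>

text \<open>The time scale is chosen so that \<open>[0, 1]\<close> runs once over the closed upper half circle;
  the full circle is \<open>\<real> / 2 \<int>\<close>.\<close>
definition hcis :: "real \<Rightarrow> complex" where
  "hcis x = cis (pi * x)"

lemma hcis_eq_iff: "hcis x = hcis y \<longleftrightarrow> (\<exists>n::int. x = y + 2 * of_int n)"
proof -
  have "hcis x = hcis y \<longleftrightarrow> cis (pi * x - pi * y) = 1"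
    by (simp add: hcis_def flip: cis_divide)
  also have "\<dots> \<longleftrightarrow> (\<exists>n::int. pi * (x - y) = pi * (2 * of_int n))"
    by (simp add: cis_eq_1_iff algebra_simps)
  also have "\<dots> \<longleftrightarrow> (\<exists>n::int. x = y + 2 * of_int n)"
    unfolding mult_cancel_left by (simp add: algebra_simps)
  finally show ?thesis .
qed

lemma continuous_on_hcis [continuous_intros]:
  "continuous_on S g \<Longrightarrow> continuous_on S (\<lambda>x. hcis (g x))"
  unfolding hcis_def by (intro continuous_intros)

lemma norm_hcis [simp]: "cmod (hcis x) = 1"
  by (simp add: hcis_def)

lemma hcis_in_circle: "hcis x \<in> sphere 0 1"
  by simp

lemma circle_eq_hcis:
  assumes "z \<in> sphere 0 1"
  obtains x where "0 \<le> x" "x < 2" "z = hcis x"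
proof -
  have "z = cis (Arg2pi z)"
    using assms Arg2pi[of z] by (simp add: cis_conv_exp is_Arg_def)
  moreover have "0 \<le> Arg2pi z / pi" "Arg2pi z / pi < 2"
    using Arg2pi_ge_0[of z] Arg2pi_lt_2pi[of z] by (auto simp: field_simps)
  moreover have "z = hcis (Arg2pi z / pi)"
    using calculation(1) by (simp add: hcis_def)
  ultimately show ?thesis using that by blast
qed

text \<open>Strict monotonicity of the extension is easy across integers, where continuity is awkward.
  So continuity is obtained last, from monotonicity together with surjectivity.\<close>
lemma periodic_extension:
  fixes \<psi> :: "real \<Rightarrow> real"
  assumes cont: "continuous_on {0..1} \<psi>" and mono: "strict_mono_on {0..1} \<psi>"
    and period: "\<psi> 1 = \<psi> 0 + 1"
  obtains F where "continuous_on UNIV F" "strict_mono F" "\<And>x. F (x + 1) = F x + 1"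
    "\<And>x. x \<in> {0..1} \<Longrightarrow> F x = \<psi> x"
proof -
  define F where "F x = \<psi> (frac x) + of_int \<lfloor>x\<rfloor>" for x :: real
  have less: "\<psi> x < \<psi> y" if "0 \<le> x" "x < y" "y \<le> 1" for x y
    using mono that by (auto simp: strict_mono_on_def)
  have fr: "0 \<le> frac x" "frac x < 1" "frac x \<le> 1" for x :: real
    using frac_lt_1[of x] by (auto simp: less_imp_le)
  have \<psi>0: "\<psi> 0 \<le> \<psi> (frac x)" for x
    using less[of 0 "frac x"] fr[of x] by (metis less_eq_real_def)
  have smono: "strict_mono F"
  proof (rule strict_monoI)
    fix x y :: real assume "x < y"
    show "F x < F y"
    proof (cases "\<lfloor>x\<rfloor> = \<lfloor>y\<rfloor>")
      case True
      then have "frac x < frac y" using \<open>x < y\<close> by (simp add: frac_def)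
      then show ?thesis using less[of "frac x" "frac y"] fr True by (simp add: F_def)
    next
      case False
      then have "\<lfloor>x\<rfloor> + 1 \<le> \<lfloor>y\<rfloor>" using \<open>x < y\<close> floor_mono[of x y] by linarith
      then have "real_of_int \<lfloor>x\<rfloor> + 1 \<le> real_of_int \<lfloor>y\<rfloor>" by linarith
      moreover have "\<psi> (frac x) < \<psi> 1" using less[of "frac x" 1] fr by simp
      ultimately show ?thesis using period \<psi>0[of y] unfolding F_def by linarith
    qed
  qed
  have per: "F (x + 1) = F x + 1" for x
    by (simp add: F_def frac_def)
  have surj: "\<exists>x. F x = y" for y
  proof -
    define n where "n = \<lfloor>y - \<psi> 0\<rfloor>"
    have n: "\<psi> 0 \<le> y - of_int n" "y - of_int n < \<psi> 1"
      using period by (auto simp: n_def; linarith)+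
    obtain x where x: "0 \<le> x" "x \<le> 1" "\<psi> x = y - of_int n"
      using IVT'[of \<psi> 0 "y - of_int n" 1] n cont by auto
    with n have "x < 1" by (cases "x = 1") auto
    then have "\<lfloor>x + of_int n\<rfloor> = n" using x by linarith
    then have "F (x + of_int n) = y" using x by (simp add: F_def frac_def)
    then show ?thesis ..
  qed
  have "range F = UNIV" using surj by (metis surj_def)
  then have "continuous_on UNIV F"
    using smono by (intro continuous_onI_mono) (auto simp: strict_mono_less_eq)
  moreover have "F x = \<psi> x" if "x \<in> {0..1}" for x
  proof (cases "x = 1")
    case True then show ?thesis using period by (simp add: F_def)
  next
    case False
    then have "\<lfloor>x\<rfloor> = 0" using that by (simp add: floor_eq_iff)
    then show ?thesis by (simp add: F_def frac_def)
  qed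
  ultimately show ?thesis using that[of F] smono per by blast
qed

lemma lift_add_int:
  fixes F :: "real \<Rightarrow> real"
  assumes "\<And>x. F (x + 1) = F x + 1"
  shows "F (x + of_int n) = F x + of_int n"
proof (induction n arbitrary: x rule: int_induct[where k = 0])
  case (step1 i)
  then show ?case using assms[of "x + of_int i"] by (simp add: add.assoc)
next
  case (step2 i)
  then show ?case using assms[of "x + of_int i - 1"] by (simp add: algebra_simps)
qed simp

text \<open>A fixed point traps every orbit of the lift between two consecutive translates of that fixed
  point. Orbits are therefore bounded, and their mean displacement tends to zero.\<close>
lemma iterates_of_lift_with_fixed_point:
  fixes F :: "real \<Rightarrow> real"
  assumes mono: "strict_mono F" and per: "\<And>x. F (x + 1) = F x + 1" and "F p = p"
  shows "(\<lambda>n. (F ^^ n) x / real n) \<longlonglongrightarrow> 0"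
proof -
  define k where "k = \<lfloor>x - p\<rfloor>"
  define a where "a = p + of_int k"
  have fix_a: "F a = a"
    unfolding a_def using lift_add_int[of F p k] per \<open>F p = p\<close> by simp
  have fix_a1: "F (a + 1) = a + 1" using per[of a] fix_a by simp
  have "a \<le> x" "x \<le> a + 1" unfolding a_def k_def by linarith+
  then have bounds: "a \<le> (F ^^ n) x \<and> (F ^^ n) x \<le> a + 1" for n
  proof (induction n)
    case (Suc n)
    then show ?case
      using strict_mono_less_eq[OF mono] fix_a fix_a1 by (metis funpow.simps(2) o_apply)
  qed simp
  show ?thesis
  proof (rule tendsto_sandwich)
    show "\<forall>\<^sub>F n in sequentially. a / real n \<le> (F ^^ n) x / real n"
      using bounds by (intro always_eventually) (auto intro: divide_right_mono)
    show "\<forall>\<^sub>F n in sequentially. (F ^^ n) x / real n \<le> (a + 1) / real n"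
      using bounds by (intro always_eventually) (auto intro: divide_right_mono)
  qed (auto intro: lim_const_over_n)
qed

lemma circle_homeomorphism_of_lift:
  fixes F :: "real \<Rightarrow> real"
  assumes cont: "continuous_on UNIV F" and mono: "strict_mono F"
    and per: "\<And>x. F (x + 1) = F x + 1" and "F p = p"
  obtains f where "homeomorphic_map circle circle f" "has_rotation_number f 0"
    "\<And>x. f (hcis x) = hcis (2 * F (x / 2))"
proof -
  define f where "f z = hcis (2 * F (Arg2pi z / pi / 2))" for z
  have f: "f (hcis x) = hcis (2 * F (x / 2))" for x
  proof -
    have "hcis x = hcis (Arg2pi (hcis x) / pi)"
      using Arg2pi[of "hcis x"] by (simp add: hcis_def cis_conv_exp is_Arg_def)
    then obtain n :: int where n: "Arg2pi (hcis x) / pi = x + 2 * of_int n"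
      by (metis hcis_eq_iff)
    have "F (Arg2pi (hcis x) / pi / 2) = F (x / 2 + of_int n)"
      unfolding n by (simp add: add_divide_distrib)
    then have "2 * F (Arg2pi (hcis x) / pi / 2) = 2 * F (x / 2) + 2 * of_int n"
      using lift_add_int[of F "x / 2" n] per by simp
    then show ?thesis unfolding f_def hcis_eq_iff by blast
  qed
  have surjF: "\<exists>x. F x = y" for y
  proof -
    define n where "n = \<lfloor>y - F 0\<rfloor>"
    have "F (of_int n) \<le> y" "y \<le> F (of_int n + 1)"
      using lift_add_int[of F 0 n] per by (auto simp: n_def; linarith)+
    then show ?thesis
      using IVT'[of F "of_int n" y "of_int n + 1"] continuous_on_subset[OF cont] by auto
  qed
  have inj: "inj_on f (sphere 0 1)"
  proof (rule inj_onI)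
    fix z w :: complex assume "z \<in> sphere 0 1" "w \<in> sphere 0 1" "f z = f w"
    then obtain x y where xy: "z = hcis x" "w = hcis y" by (metis circle_eq_hcis)
    then obtain n :: int where "2 * F (x / 2) = 2 * F (y / 2) + 2 * of_int n"
      using \<open>f z = f w\<close> f hcis_eq_iff by metis
    then have "F (x / 2) = F (y / 2 + of_int n)"
      using lift_add_int[of F "y / 2" n] per by simp
    then have "x / 2 = y / 2 + of_int n" using strict_mono_eq[OF mono] by simp
    then have "x = y + 2 * of_int n" by simp
    then show "z = w" unfolding xy hcis_eq_iff by blast
  qed
  have surj: "f ` sphere 0 1 = sphere 0 1"
  proof
    show "f ` sphere 0 1 \<subseteq> sphere 0 1" by (auto simp: f_def hcis_def)
    show "sphere 0 1 \<subseteq> f ` sphere 0 1"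
    proof
      fix z :: complex assume "z \<in> sphere 0 1"
      then obtain y where y: "z = hcis y" by (metis circle_eq_hcis)
      obtain x where "F x = y / 2" using surjF by blast
      then have "2 * F x = y" by simp
      then have "f (hcis (2 * x)) = z" using f[of "2 * x"] y by simp
      then show "z \<in> f ` sphere 0 1" by (metis hcis_in_circle imageI)
    qed
  qed
  have "continuous_on (sphere 0 1) f"
    unfolding continuous_on_closed_vimage[OF closed_sphere]
  proof (intro allI impI)
    fix T :: "complex set" assume "closed T"
    let ?P = "(\<lambda>x. hcis (2 * F (x / 2))) -` T \<inter> {0..2}"
    \<comment> \<open>The circle is a quotient of a compact interval, so closedness is tested upstairs.\<close>
    have "continuous_on {0..2} (\<lambda>x. F (x / 2))"
      by (intro continuous_on_compose2[OF cont] continuous_intros) auto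
    then have "continuous_on {0..2} (\<lambda>x. hcis (2 * F (x / 2)))"
      by (intro continuous_intros)
    then have "closed ?P"
      using \<open>closed T\<close> by (metis closed_atLeastAtMost continuous_on_closed_vimage)
    then have "compact ?P"
      by (metis compact_Icc compact_Int_closed inf_commute inf_idem inf_left_commute)
    then have "compact (hcis ` ?P)"
      by (intro compact_continuous_image continuous_intros)
    moreover have "hcis ` ?P = f -` T \<inter> sphere 0 1"
    proof
      show "hcis ` ?P \<subseteq> f -` T \<inter> sphere 0 1" using f by auto
      show "f -` T \<inter> sphere 0 1 \<subseteq> hcis ` ?P"
      proof
        fix z assume z: "z \<in> f -` T \<inter> sphere 0 1"
        then obtain x where x: "0 \<le> x" "x < 2" "z = hcis x" by (metis IntD2 circle_eq_hcis)
        then show "z \<in> hcis ` ?P" using z f[of x] by (intro image_eqI[of _ _ x]) auto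
      qed
    qed
    ultimately show "closed (f -` T \<inter> sphere 0 1)" by (simp add: compact_imp_closed)
  qed
  then have "homeomorphic_map circle circle f"
    using inj surj
    by (intro continuous_imp_homeomorphic_map)
       (auto simp: Hausdorff_space_subtopology compact_space_subtopology)
  moreover have "circle_lift F f"
    unfolding circle_lift_def
  proof (intro conjI allI)
    fix x show "f (cis (2 * pi * x)) = cis (2 * pi * F x)"
      using f[of "2 * x"] by (simp add: hcis_def mult_ac)
  qed (use cont mono per in auto)
  then have "has_rotation_number f 0"
    unfolding has_rotation_number_def
    using iterates_of_lift_with_fixed_point[OF mono per \<open>F p = p\<close>] by (intro exI conjI allI) auto
  ultimately show ?thesis using that f by blast
qed

text \<open>This is where rotation number zero comes for free. A self-embedding of an arc has a fixed point
  by the intermediate value theorem, and since its image is contained in the arc, the complementary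
  arc can be sent affinely onto the complement of the image. The offset \<open>t\<close> selects the half circle
  on which the given map is realised.\<close>
lemma circle_homeomorphism_of_arc_map:
  fixes \<phi> :: "real \<Rightarrow> real"
  assumes cont: "continuous_on {0..1} \<phi>" and mono: "strict_mono_on {0..1} \<phi>"
    and maps: "\<phi> ` {0..1} \<subseteq> {0..1}"
  obtains f where "homeomorphic_map circle circle f" "has_rotation_number f 0"
    "\<And>x. x \<in> {0..1} \<Longrightarrow> f (hcis (x + t)) = hcis (\<phi> x + t)"
proof -
  \<comment> \<open>One period of the lift: the given map on the first half, and on the second half the affine
    map that reaches the next translate of \<open>\<phi> 0\<close>.\<close>
  define \<psi> where "\<psi> s = (if s \<le> 1/2 then \<phi> (2 * s) / 2
      else \<phi> 1 / 2 + (s - 1/2) * (\<phi> 0 + 2 - \<phi> 1))" for s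
  have range: "0 \<le> \<phi> x" "\<phi> x \<le> 1" if "0 \<le> x" "x \<le> 1" for x
    using maps that by (auto simp: image_subset_iff)
  have less: "\<phi> x < \<phi> y" if "0 \<le> x" "x < y" "y \<le> 1" for x y
    using mono that by (auto simp: strict_mono_on_def)
  have slope: "0 < \<phi> 0 + 2 - \<phi> 1"
    using range[of 0] range[of 1] by linarith
  have "continuous_on ({0..1/2} \<union> {1/2..1}) \<psi>"
    unfolding \<psi>_def
  proof (rule continuous_on_cases)
    show "continuous_on {0..1/2} (\<lambda>s. \<phi> (2 * s) / 2)"
      by (intro continuous_intros continuous_on_compose2[OF cont]) auto
    have "\<phi> (2 * s) / 2 = \<phi> 1 / 2 + (s - 1/2) * (\<phi> 0 + 2 - \<phi> 1)" if "s = 1/2" for s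
      unfolding that by simp
    then show "\<forall>s. s \<in> {0..1/2} \<and> \<not> s \<le> 1/2 \<or> s \<in> {1/2..1} \<and> s \<le> 1/2 \<longrightarrow>
        \<phi> (2 * s) / 2 = \<phi> 1 / 2 + (s - 1/2) * (\<phi> 0 + 2 - \<phi> 1)" by auto
  qed (auto intro!: continuous_intros)
  then have cont\<psi>: "continuous_on {0..1} \<psi>" by (simp add: ivl_disj_un_two_touch)
  have mono\<psi>: "strict_mono_on {0..1} \<psi>"
  proof (rule strict_mono_onI)
    fix x y :: real assume xy: "x \<in> {0..1}" "y \<in> {0..1}" "x < y"
    consider "y \<le> 1/2" | "x \<le> 1/2" "1/2 < y" | "1/2 < x" by linarith
    then show "\<psi> x < \<psi> y"
    proof cases
      case 1
      then show ?thesis using xy less[of "2 * x" "2 * y"] by (simp add: \<psi>_def)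
    next
      case 2
      then have "\<phi> (2 * x) \<le> \<phi> 1"
        using xy less[of "2 * x" 1] by (cases "2 * x = 1") auto
      moreover have "0 < (y - 1/2) * (\<phi> 0 + 2 - \<phi> 1)"
        using 2 slope by (intro mult_pos_pos) auto
      ultimately show ?thesis using 2 by (simp add: \<psi>_def)
    next
      case 3
      then show ?thesis using xy slope by (simp add: \<psi>_def mult_strict_right_mono)
    qed
  qed
  have per\<psi>: "\<psi> 1 = \<psi> 0 + 1" by (simp add: \<psi>_def field_simps)
  obtain F where F: "continuous_on UNIV F" "strict_mono F" "\<And>x. F (x + 1) = F x + 1"
    "\<And>x. x \<in> {0..1} \<Longrightarrow> F x = \<psi> x"
    using periodic_extension[OF cont\<psi> mono\<psi> per\<psi>] by blast
  have F\<phi>: "F (x / 2) = \<phi> x / 2" if "x \<in> {0..1}" for x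
    using F(4)[of "x / 2"] that by (simp add: \<psi>_def)
  have "continuous_on {0..1} (\<lambda>x. \<phi> x - x)"
    by (intro continuous_intros cont)
  then obtain q where q: "0 \<le> q" "q \<le> 1" "\<phi> q = q"
    using IVT2'[of "\<lambda>x. \<phi> x - x" 1 0 0] range[of 0] range[of 1] by auto
  define G where "G x = F (x - t / 2) + t / 2" for x
  obtain f where f: "homeomorphic_map circle circle f" "has_rotation_number f 0"
    "\<And>x. f (hcis x) = hcis (2 * G (x / 2))"
  proof (rule circle_homeomorphism_of_lift[of G "q / 2 + t / 2"])
    show "continuous_on UNIV G"
      unfolding G_def by (intro continuous_intros continuous_on_compose2[OF F(1)]) auto
    show "strict_mono G"
      using F(2) by (auto simp: G_def strict_mono_def)
    show "G (x + 1) = G x + 1" for x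
      using F(3)[of "x - t / 2"] by (simp add: G_def algebra_simps)
    show "G (q / 2 + t / 2) = q / 2 + t / 2"
      using F\<phi>[of q] q by (simp add: G_def)
  qed blast
  have "f (hcis (x + t)) = hcis (\<phi> x + t)" if "x \<in> {0..1}" for x
    using f(3)[of "x + t"] F\<phi>[OF that] by (simp add: G_def add_divide_distrib)
  then show ?thesis using that f by blast
qed

section \<open>Minimality\<close>

text \<open>Orbit closures are closed and invariant, so minimality only has to be tested on closed
  invariant subsets; words never have to be mentioned again.\<close>
lemma minimal_setI:
  assumes homeo: "\<And>f. f \<in> set fs \<Longrightarrow> homeomorphic_map circle circle f"
    and M: "M \<noteq> {}" "M \<subseteq> sphere 0 1" "closed M" "invariant_set fs M"
    and min: "\<And>D. \<lbrakk>closed D; D \<noteq> {}; D \<subseteq> M; invariant_set fs D\<rbrakk> \<Longrightarrow> M \<subseteq> D"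
  shows "minimal_set fs M"
proof -
  have contf: "continuous_on (sphere 0 1) f" if "f \<in> set fs" for f
    using homeomorphic_imp_continuous_map[OF homeo[OF that]] by simp
  have "circle closure_of (orbit fs x) = M" if "x \<in> M" for x
  proof -
    have word: "foldr (\<circ>) w id x \<in> M" if "set w \<subseteq> set fs" for w
      using that \<open>x \<in> M\<close> M(4) by (induction w) (auto simp: invariant_set_def)
    then have orb: "orbit fs x \<subseteq> M" by (auto simp: orbit_def IFS_def)
    have "x \<in> orbit fs x"
      unfolding orbit_def IFS_def by (auto intro!: exI[of _ "[]"] exI[of _ id])
    moreover have "f ` orbit fs x \<subseteq> orbit fs x" if "f \<in> set fs" for f
    proof
      fix z assume "z \<in> f ` orbit fs x"
      then obtain w where "set w \<subseteq> set fs" "z = f (foldr (\<circ>) w id x)"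
        by (auto simp: orbit_def IFS_def)
      then have "set (f # w) \<subseteq> set fs" "z = foldr (\<circ>) (f # w) id x"
        using that by auto
      then show "z \<in> orbit fs x" unfolding orbit_def IFS_def by blast
    qed
    moreover have sub: "closure (orbit fs x) \<subseteq> M"
      using orb M(3) by (simp add: closure_minimal)
    ultimately have "M \<subseteq> closure (orbit fs x)"
    proof (intro min)
      show "closure (orbit fs x) \<noteq> {}" using \<open>x \<in> orbit fs x\<close> closure_subset by blast
      show "invariant_set fs (closure (orbit fs x))"
        unfolding invariant_set_def
      proof
        fix f assume f: "f \<in> set fs"
        show "f ` closure (orbit fs x) \<subseteq> closure (orbit fs x)"
        proof (rule image_closure_subset)
          show "continuous_on (closure (orbit fs x)) f"
            using contf[OF f] sub M(2) by (meson continuous_on_subset order_trans)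
          show "f ` orbit fs x \<subseteq> closure (orbit fs x)"
            using \<open>f \<in> set fs \<Longrightarrow> f ` orbit fs x \<subseteq> orbit fs x\<close> f closure_subset by blast
        qed simp
      qed
    qed auto
    moreover have "sphere 0 1 \<inter> orbit fs x = orbit fs x"
      using orb M(2) by blast
    ultimately show ?thesis
      using sub M(2) by (auto simp: closure_of_subtopology)
  qed
  then show ?thesis
    using M unfolding minimal_set_def by (auto simp: closedin_closed_eq)
qed

text \<open>The usual uniqueness argument for attractors of contractions: pulling a point of \<open>A\<close> back along
  the cover either ends in \<open>S\<close> or yields, after \<open>n\<close> steps, an approximation of order \<open>c ^ n\<close> by a
  point of \<open>S\<close>. Allowing \<open>A\<close> to be covered partly by \<open>S\<close> itself admits sets generated from a
  condensation set. The lemma serves three purposes below: filling an interval, filling a Cantor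
  set, and approximating a Cantor set by points outside a larger set.\<close>
lemma contraction_approximation:
  fixes A S :: "'a::metric_space set"
  assumes cover: "A \<subseteq> S \<union> (\<Union>h\<in>H. h ` A)"
    and S: "S \<noteq> {}" "\<And>h. h \<in> H \<Longrightarrow> h ` S \<subseteq> S"
    and bdd: "bounded A" "bounded S"
    and c: "0 \<le> c" "c < 1" "\<And>h x y. \<lbrakk>h \<in> H; x \<in> A; y \<in> S\<rbrakk> \<Longrightarrow> dist (h x) (h y) \<le> c * dist x y"
  shows "A \<subseteq> closure S"
proof
  fix x assume "x \<in> A"
  obtain B where B: "\<And>x y. \<lbrakk>x \<in> A; y \<in> S\<rbrakk> \<Longrightarrow> dist x y \<le> B"
    using bounded_two_points[of "A \<union> S"] bdd by (meson UnCI bounded_Un)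
  have approx: "\<exists>y\<in>S. dist x y \<le> c ^ n * \<bar>B\<bar>" if "x \<in> A" for n x
    using that
  proof (induction n arbitrary: x)
    case 0
    then show ?case using B S(1) by (force intro: order_trans[OF _ abs_ge_self])
  next
    case (Suc n)
    show ?case
    proof (cases "x \<in> S")
      case True
      then show ?thesis using c(1) by (intro bexI[of _ x]) auto
    next
      case False
      then obtain h x' where h: "h \<in> H" "x' \<in> A" "x = h x'" using cover Suc.prems by blast
      obtain y where y: "y \<in> S" "dist x' y \<le> c ^ n * \<bar>B\<bar>" using Suc.IH h(2) by blast
      have "dist x (h y) \<le> c * dist x' y" using c(3) h y(1) by simp
      also have "\<dots> \<le> c * (c ^ n * \<bar>B\<bar>)" using y(2) c(1) by (rule mult_left_mono)
      finally show ?thesis using S(2)[OF h(1)] y(1) by (intro bexI[of _ "h y"]) (auto simp: mult_ac)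
    qed
  qed
  have "(\<lambda>n. c ^ n * \<bar>B\<bar>) \<longlonglongrightarrow> 0"
    using c by (auto intro!: tendsto_mult_left_zero LIMSEQ_power_zero)
  show "x \<in> closure S"
    unfolding closure_approachable
  proof (intro allI impI)
    fix e :: real assume "0 < e"
    with \<open>(\<lambda>n. c ^ n * \<bar>B\<bar>) \<longlonglongrightarrow> 0\<close> obtain n where "c ^ n * \<bar>B\<bar> < e"
      by (metis (no_types, lifting) eventually_sequentially order_refl order_tendstoD(2))
    then show "\<exists>y\<in>S. dist y x < e" using approx[OF \<open>x \<in> A\<close>, of n] by (force simp: dist_commute)
  qed
qed

section \<open>Subsets of the half circle\<close>

lemma islimpt_injective_image:
  assumes "x islimpt S" "continuous_on (insert x S) f" "inj_on f (insert x S)"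
  shows "f x islimpt f ` S"
proof (rule islimptI)
  fix T assume T: "f x \<in> T" "open T"
  then obtain U where U: "open U" "x \<in> U" "\<And>y. \<lbrakk>y \<in> insert x S; y \<in> U\<rbrakk> \<Longrightarrow> f y \<in> T"
    using assms(2) unfolding continuous_on_topological by (metis insertI1)
  obtain y where "y \<in> S" "y \<in> U" "y \<noteq> x" using islimptE[OF assms(1) U(2,1)] by metis
  then show "\<exists>z\<in>f ` S. z \<in> T \<and> z \<noteq> f x"
    using U(3) inj_onD[OF assms(3), of y x] by (intro bexI[of _ "f y"]) auto
qed

lemma cantor_set_injective_image:
  fixes f :: "'a::t2_space \<Rightarrow> 'b::t2_space"
  assumes C: "cantor_set C" and f: "continuous_on C f" "inj_on f C"
  shows "cantor_set (f ` C)"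
proof -
  have C': "C \<noteq> {}" "compact C" "\<And>x. x \<in> C \<Longrightarrow> x islimpt C"
    "\<And>x. x \<in> C \<Longrightarrow> connected_component_set C x = {x}"
    using C by (auto simp: cantor_set_def perfect_set_def totally_disconnected_def)
  have compact: "compact (f ` C)" using f(1) C'(2) by (rule compact_continuous_image)
  have "f x islimpt f ` C" if "x \<in> C" for x
    using islimpt_injective_image[OF C'(3)[OF that]] f that by (simp add: insert_absorb)
  then have perfect: "perfect_set (f ` C)"
    using compact by (auto simp: perfect_set_def compact_imp_closed)
  obtain g where g: "homeomorphism C (f ` C) f g"
    using homeomorphism_compact[OF C'(2) f(1) refl f(2)] by blast
  have "z = f x" if xC: "x \<in> C" and z: "connected_component (f ` C) (f x) z" for x z
  proof -
    obtain T where T: "connected T" "T \<subseteq> f ` C" "f x \<in> T" "z \<in> T"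
      using z by (auto simp: connected_component_def)
    have "continuous_on T g"
      using g T(2) by (meson continuous_on_subset homeomorphism_cont2)
    then have "connected (g ` T)" using T(1) by (rule connected_continuous_image)
    moreover have "g ` T \<subseteq> C" using T(2) g homeomorphism_image2 by blast
    moreover have "x \<in> g ` T" using T(3) g xC by (metis homeomorphism_apply1 imageI)
    ultimately have "g z \<in> connected_component_set C x"
      using T(4) by (auto simp: connected_component_def)
    then have "g z = x" using C'(4)[OF xC] by simp
    then show ?thesis using g T(2,4) by (metis homeomorphism_apply2 subset_iff)
  qed
  then have "totally_disconnected (f ` C)"
    by (auto simp: totally_disconnected_def)
  then show ?thesis using C'(1) compact perfect by (auto simp: cantor_set_def)
qed

definition arc_coord :: "complex \<Rightarrow> real" where
  "arc_coord z = arccos (Re z) / pi"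

lemma arc_coord_hcis [simp]: "x \<in> {0..1} \<Longrightarrow> arc_coord (hcis x) = x"
  by (simp add: arc_coord_def hcis_def arccos_cos mult_left_le)

lemma inj_on_hcis: "X \<subseteq> {0..1} \<Longrightarrow> inj_on hcis X"
  by (metis arc_coord_hcis inj_onI subsetD)

lemma continuous_on_arc_coord: "continuous_on (sphere 0 1) arc_coord"
  unfolding arc_coord_def
proof (intro continuous_intros ballI)
  fix z :: complex assume "z \<in> sphere 0 1"
  then show "-1 \<le> Re z \<and> Re z \<le> 1" using abs_Re_le_cmod[of z] by (auto simp: abs_le_iff)
qed simp

lemma hcis_arc_coord:
  assumes "X \<subseteq> {0..1}" "D \<subseteq> hcis ` X"
  shows "\<And>z. z \<in> D \<Longrightarrow> hcis (arc_coord z) = z" "arc_coord ` D \<subseteq> X"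
proof -
  have "hcis (arc_coord z) = z \<and> arc_coord z \<in> X" if "z \<in> D" for z
    using that assms arc_coord_hcis by (metis (no_types, lifting) imageE subset_iff)
  then show "\<And>z. z \<in> D \<Longrightarrow> hcis (arc_coord z) = z" "arc_coord ` D \<subseteq> X" by auto
qed

lemma open_arc_image:
  assumes "open T"
  shows "openin circle (hcis ` (T \<inter> {0<..<1}))"
proof -
  let ?P = "sphere 0 1 \<inter> arc_coord -` T"
  have "openin circle ?P"
    using continuous_on_arc_coord assms
    by (rule continuous_openin_preimage_gen)
  moreover have "openin circle (sphere 0 1 \<inter> {z. 0 < Im z})"
    by (intro openin_open_Int open_halfspace_Im_gt)
  ultimately have "openin circle (?P \<inter> (sphere 0 1 \<inter> {z. 0 < Im z}))"
    by (rule openin_Int)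
  moreover have "?P \<inter> (sphere 0 1 \<inter> {z. 0 < Im z}) = hcis ` (T \<inter> {0<..<1})"
  proof
    show "hcis ` (T \<inter> {0<..<1}) \<subseteq> ?P \<inter> (sphere 0 1 \<inter> {z. 0 < Im z})"
    proof
      fix z assume "z \<in> hcis ` (T \<inter> {0<..<1})"
      then obtain x where x: "z = hcis x" "x \<in> T" "0 < x" "x < 1" by auto
      then have "0 < sin (pi * x)" by (intro sin_gt_zero) auto
      then have "0 < Im (hcis x)" by (simp add: hcis_def)
      then show "z \<in> ?P \<inter> (sphere 0 1 \<inter> {z. 0 < Im z})" using x by simp
    qed
    show "?P \<inter> (sphere 0 1 \<inter> {z. 0 < Im z}) \<subseteq> hcis ` (T \<inter> {0<..<1})"
    proof
      fix z assume z: "z \<in> ?P \<inter> (sphere 0 1 \<inter> {z. 0 < Im z})"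
      then obtain x where x: "0 \<le> x" "x < 2" "z = hcis x" by (metis IntD1 circle_eq_hcis)
      have "0 < sin (pi * x)" using z x by (simp add: hcis_def)
      moreover have "sin (pi * x) \<le> 0" if "1 \<le> x"
        using that x by (intro sin_le_zero) auto
      ultimately have "x < 1" "x \<noteq> 0" by (force, force)
      then show "z \<in> hcis ` (T \<inter> {0<..<1})" using z x by auto
    qed
  qed
  ultimately show ?thesis by simp
qed

lemma interior_subset_01: "X \<subseteq> {0..1} \<Longrightarrow> interior X \<subseteq> {0<..<1::real}"
  using interior_mono[of X "{0..1}"] by simp

text \<open>The endpoints of the half circle need care: a relative neighbourhood of such a point in the
  circle leaves the half circle, just as a neighbourhood of \<open>0\<close> or \<open>1\<close> leaves the unit interval.\<close>
lemma interior_of_arc_image: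
  assumes "X \<subseteq> {0..1}"
  shows "circle interior_of (hcis ` X) = hcis ` interior X"
proof
  show "hcis ` interior X \<subseteq> circle interior_of (hcis ` X)"
  proof (rule interior_of_maximal)
    show "hcis ` interior X \<subseteq> hcis ` X" by (simp add: image_mono interior_subset)
    show "openin circle (hcis ` interior X)"
      using open_arc_image[of "interior X"] interior_subset_01[OF assms] by (simp add: Int_absorb2)
  qed
  show "circle interior_of (hcis ` X) \<subseteq> hcis ` interior X"
  proof
    fix z assume "z \<in> circle interior_of (hcis ` X)"
    then obtain T where T: "openin circle T" "z \<in> T" "T \<subseteq> hcis ` X"
      by (auto simp: interior_of_def)
    then obtain V where V: "open V" "T = sphere 0 1 \<inter> V"
      by (auto simp: openin_open)
    obtain x where x: "x \<in> X" "z = hcis x" using T by blast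
    \<comment> \<open>On this neighbourhood of \<open>[0, 1]\<close>, which reaches past both ends of the half circle,
      the parametrisation is still injective.\<close>
    let ?U = "hcis -` V \<inter> {-1/2<..<3/2}"
    have "open (hcis -` V)"
      using V(1) by (intro open_vimage) (auto intro: continuous_intros)
    then have "open ?U" by (intro open_Int) auto
    moreover have "x \<in> ?U" using x T V assms by auto
    moreover have "?U \<subseteq> X"
    proof
      fix y assume y: "y \<in> ?U"
      then have "hcis y \<in> hcis ` X" using T V by auto
      then obtain w where w: "w \<in> X" "hcis y = hcis w" by blast
      then obtain n :: int where n: "y = w + 2 * of_int n" using hcis_eq_iff by blast
      have "0 \<le> w" "w \<le> 1" using w assms by auto
      then have "\<bar>real_of_int n\<bar> < 1" using n y by auto
      then have "n = 0" by linarith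
      then show "y \<in> X" using n w by simp
    qed
    ultimately have "x \<in> interior X" by (rule interiorI)
    then show "z \<in> hcis ` interior X" using x by blast
  qed
qed

lemma closed_arc_image:
  assumes "closed X" "X \<subseteq> {0..1}"
  shows "compact (hcis ` X)"
proof -
  have "compact X" using assms compact_Icc by (metis closed_Int_compact inf.absorb_iff1)
  then show ?thesis by (intro compact_continuous_image continuous_intros)
qed

lemma canonical_decomposition_without_cantor_set:
  assumes X: "closed X" "X \<subseteq> {0..1}" and fin: "finite (X - interior X)"
  shows "canonical_decomposition (hcis ` X) (hcis ` interior X) {} (hcis ` (X - interior X))"
proof -
  have diff: "hcis ` X - hcis ` interior X = hcis ` (X - interior X)"
    using inj_on_image_set_diff[OF inj_on_hcis[OF X(2)]] interior_subset by (metis Diff_subset)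
  have "\<not> cantor_set D" if "D \<subseteq> hcis ` (X - interior X)" for D
  proof
    assume "cantor_set D"
    then obtain x where "x islimpt D" by (auto simp: cantor_set_def perfect_set_def)
    moreover have "finite D" using that fin finite_subset by blast
    ultimately show False using islimpt_finite by blast
  qed
  moreover have "closedin circle (hcis ` X)"
    using closed_arc_image[OF X] by (auto simp: closedin_closed_eq compact_imp_closed)
  ultimately show ?thesis
    using diff by (auto simp: canonical_decomposition_def interior_of_arc_image[OF X(2)])
qed

text \<open>Maximality is inherited from the real line because \<open>arc_coord\<close> carries a Cantor set on the half
  circle back to one in the unit interval.\<close>
lemma canonical_decomposition_with_cantor_set:
  assumes X: "closed X" "X \<subseteq> {0..1}" and C: "cantor_set C" "C \<subseteq> X - interior X"
    and max: "\<And>D. \<lbrakk>cantor_set D; D \<subseteq> X - interior X\<rbrakk> \<Longrightarrow> D \<subseteq> C"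
  shows "canonical_decomposition (hcis ` X) (hcis ` interior X) (hcis ` C)
    (hcis ` (X - interior X - C))"
proof -
  note inj = inj_on_hcis[OF X(2)]
  have diff: "hcis ` X - hcis ` interior X = hcis ` (X - interior X)"
    using inj_on_image_set_diff[OF inj] interior_subset by (metis Diff_subset)
  have "hcis ` (X - interior X) - hcis ` C = hcis ` (X - interior X - C)"
    using inj_on_image_set_diff[OF inj, of "X - interior X" C] C(2) by blast
  then have N: "hcis ` (X - interior X - C) = hcis ` X - (hcis ` interior X \<union> hcis ` C)"
    using diff by blast
  have cC: "cantor_set (hcis ` C)"
    using C X(2) by (intro cantor_set_injective_image C inj_on_hcis continuous_intros) auto
  have max': "D \<subseteq> hcis ` C" if D: "cantor_set D" "D \<subseteq> hcis ` (X - interior X)" for D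
  proof -
    have sub: "X - interior X \<subseteq> {0..1}" using X(2) by blast
    note co = hcis_arc_coord[OF sub D(2)]
    have "D \<subseteq> sphere 0 1" using D(2) hcis_in_circle by blast
    then have "cantor_set (arc_coord ` D)"
      using D(1) continuous_on_subset[OF continuous_on_arc_coord] inj_on_inverseI[of D hcis, OF co(1)]
      by (intro cantor_set_injective_image) auto
    then have "arc_coord ` D \<subseteq> C" using co(2) by (rule max)
    then show ?thesis using co(1) by (metis imageI image_subset_iff subsetI)
  qed
  have "maximal_cantor_subset (hcis ` C) (hcis ` (X - interior X))"
    unfolding maximal_cantor_subset_def using cC C(2) max' by blast
  moreover have "closedin circle (hcis ` X)"
    using closed_arc_image[OF X] by (auto simp: closedin_closed_eq compact_imp_closed)
  ultimately show ?thesis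
    unfolding canonical_decomposition_def interior_of_arc_image[OF X(2)] Union_components diff N
    using cC C(2) by (auto intro: image_mono)
qed

text \<open>The self-embeddings of \<open>[0, 1]\<close> from which generators on the circle are made.\<close>
definition arc_map :: "(real \<Rightarrow> real) \<Rightarrow> bool" where
  "arc_map \<phi> \<longleftrightarrow> continuous_on {0..1} \<phi> \<and> strict_mono_on {0..1} \<phi> \<and> \<phi> ` {0..1} \<subseteq> {0..1}"

lemma minimal_set_of_arc_maps:
  assumes \<phi>s: "\<phi>s \<noteq> []" "\<And>\<phi>. \<phi> \<in> set \<phi>s \<Longrightarrow> arc_map \<phi> \<and> \<phi> ` X \<subseteq> X"
    and X: "X \<noteq> {}" "closed X" "X \<subseteq> {0..1}"
    and min: "\<And>S. \<lbrakk>closed S; S \<noteq> {}; S \<subseteq> X; \<And>\<phi>. \<phi> \<in> set \<phi>s \<Longrightarrow> \<phi> ` S \<subseteq> S\<rbrakk> \<Longrightarrow> X \<subseteq> S"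
  obtains fs where "fs \<noteq> []"
    "\<forall>f\<in>set fs. homeomorphic_map circle circle f \<and> has_rotation_number f 0"
    "minimal_set fs (hcis ` X)"
proof -
  have "\<exists>f. homeomorphic_map circle circle f \<and> has_rotation_number f 0 \<and>
      (\<forall>x\<in>{0..1}. f (hcis x) = hcis (\<phi> x))" if "\<phi> \<in> set \<phi>s" for \<phi>
    using circle_homeomorphism_of_arc_map[of \<phi> 0] \<phi>s(2)[OF that]
    by (metis add.right_neutral arc_map_def)
  then obtain E where E: "\<And>\<phi>. \<phi> \<in> set \<phi>s \<Longrightarrow> homeomorphic_map circle circle (E \<phi>)"
    "\<And>\<phi>. \<phi> \<in> set \<phi>s \<Longrightarrow> has_rotation_number (E \<phi>) 0"
    "\<And>\<phi> x. \<lbrakk>\<phi> \<in> set \<phi>s; x \<in> {0..1}\<rbrakk> \<Longrightarrow> E \<phi> (hcis x) = hcis (\<phi> x)"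
    by metis
  have "minimal_set (map E \<phi>s) (hcis ` X)"
  proof (rule minimal_setI)
    show "invariant_set (map E \<phi>s) (hcis ` X)"
      unfolding invariant_set_def
    proof safe
      fix f x assume "f \<in> set (map E \<phi>s)" "x \<in> X"
      then obtain \<phi> where \<phi>: "\<phi> \<in> set \<phi>s" "f = E \<phi>" by auto
      then have "f (hcis x) = hcis (\<phi> x)" using E(3) \<open>x \<in> X\<close> X(3) by blast
      then show "f (hcis x) \<in> hcis ` X" using \<phi>s(2)[OF \<phi>(1)] \<open>x \<in> X\<close> by blast
    qed
    show "hcis ` X \<noteq> {}" using X(1) by simp
    show "closed (hcis ` X)" using closed_arc_image[OF X(2,3)] by (rule compact_imp_closed)
    show "hcis ` X \<subseteq> sphere 0 1" using hcis_in_circle by blast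
    fix D assume D: "closed D" "D \<noteq> {}" "D \<subseteq> hcis ` X" "invariant_set (map E \<phi>s) D"
    define S where "S = hcis -` D \<inter> {0..1}"
    have S: "x \<in> S \<longleftrightarrow> x \<in> X \<and> hcis x \<in> D" for x
    proof
      assume "x \<in> S"
      then have x: "hcis x \<in> D" "x \<in> {0..1}" by (auto simp: S_def)
      then obtain y where "y \<in> X" "hcis x = hcis y" using D(3) by blast
      then have "x = y" using x X(3) by (metis arc_coord_hcis subsetD)
      then show "x \<in> X \<and> hcis x \<in> D" using x \<open>y \<in> X\<close> by simp
    qed (use X(3) in \<open>auto simp: S_def\<close>)
    have "X \<subseteq> S"
    proof (rule min)
      show "closed S"
        unfolding S_def using D(1) by (intro continuous_closed_preimage continuous_intros
            closed_Int closed_vimage) auto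
      show "S \<noteq> {}" using D(2,3) S by blast
      show "S \<subseteq> X" using S by blast
      show "\<phi> ` S \<subseteq> S" if "\<phi> \<in> set \<phi>s" for \<phi>
      proof
        fix y assume "y \<in> \<phi> ` S"
        then obtain x where x: "x \<in> S" "y = \<phi> x" by blast
        then have "x \<in> X" "hcis x \<in> D" using S by auto
        then have "y \<in> X" using \<phi>s(2)[OF that] x by blast
        moreover have "E \<phi> (hcis x) \<in> D"
          using D(4) that \<open>hcis x \<in> D\<close> by (auto simp: invariant_set_def)
        ultimately show "y \<in> S" using E(3)[OF that, of x] \<open>x \<in> X\<close> X(3) x S by auto
      qed
    qed
    then show "hcis ` X \<subseteq> D" using S by blast
  qed (use E(1) in auto)
  then show ?thesis using that[of "map E \<phi>s"] \<phi>s(1) E by auto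
qed

section \<open>A Cantor set with intervals inserted into its gaps\<close>

definition branch :: "real \<Rightarrow> real \<Rightarrow> real" where
  "branch d x = (x + d) / 5"

definition digits :: "real set" where
  "digits = {0, 2, 4}"

text \<open>The attractor of the three branches with condensation set \<open>J\<close>. For \<open>J = {}\<close> this is the Cantor
  set of numbers in \<open>[0, 1]\<close> with a base 5 expansion using only \<open>0\<close>, \<open>2\<close>, \<open>4\<close>; a subset \<open>J\<close> of its gap
  \<open>(1/5, 2/5)\<close> is copied into one of the two gaps of every copy of the Cantor set, while the gap
  \<open>(3/5, 4/5)\<close> always stays empty. The greatest fixed point is needed: the least one consists only of
  the copies of \<open>J\<close>, without the Cantor set on which they accumulate. The constraint to \<open>[0, 1]\<close>
  keeps the greatest fixed point bounded.\<close>
coinductive_set filled_cantor :: "real set \<Rightarrow> real set" for J where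
  fill: "x \<in> J \<Longrightarrow> x \<in> filled_cantor J"
| branch: "\<lbrakk>x \<in> filled_cantor J; x \<in> {0..1}; d \<in> digits\<rbrakk> \<Longrightarrow> branch d x \<in> filled_cantor J"

lemma branch_in_01: "\<lbrakk>x \<in> {0..1}; d \<in> digits\<rbrakk> \<Longrightarrow> branch d x \<in> {0..1}"
  by (auto simp: branch_def digits_def)

lemma branch_eq_iff:
  assumes "branch d x = branch e y" "x \<in> {0..1}" "y \<in> {0..1}" "d \<in> digits" "e \<in> digits"
  shows "d = e \<and> x = y"
  using assms by (auto simp: branch_def digits_def)

lemma branch_inverse [simp]: "5 * branch d x - d = x" "branch d (5 * x - d) = x"
  by (simp_all add: branch_def field_simps)

lemma dist_branch: "dist (branch d x) (branch d y) = 1/5 * dist x y"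
proof -
  have "branch d x - branch d y = (x - y) / 5" by (simp add: branch_def field_simps)
  then show ?thesis by (simp only: dist_real_def abs_divide)
qed

lemma continuous_on_branch [continuous_intros]:
  "continuous_on S g \<Longrightarrow> continuous_on S (\<lambda>x. branch d (g x))"
  unfolding branch_def by (intro continuous_intros) auto

lemma arc_map_branch: "d \<in> digits \<Longrightarrow> arc_map (branch d)"
  unfolding arc_map_def
  by (intro conjI continuous_intros strict_mono_onI image_subsetI branch_in_01)
     (auto simp: branch_def)

lemma filled_cantor_cases:
  assumes "x \<in> filled_cantor J"
  obtains "x \<in> J" | d y where "x = branch d y" "d \<in> digits" "y \<in> filled_cantor J" "y \<in> {0..1}"
  using assms by cases blast+

lemma filled_cantor_unfold:
  "filled_cantor J \<subseteq> J \<union> (\<Union>d\<in>digits. branch d ` (filled_cantor J \<inter> {0..1}))"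
proof
  fix x assume "x \<in> filled_cantor J"
  then show "x \<in> J \<union> (\<Union>d\<in>digits. branch d ` (filled_cantor J \<inter> {0..1}))"
    by (cases rule: filled_cantor_cases) blast+
qed

lemma filled_cantor_subset: "J \<subseteq> {0..1} \<Longrightarrow> filled_cantor J \<subseteq> {0..1}"
  using filled_cantor_unfold[of J] branch_in_01 by blast

lemma filled_cantor_coinduct:
  assumes S: "S \<subseteq> J \<union> (\<Union>d\<in>digits. branch d ` (S \<inter> {0..1}))"
  shows "S \<subseteq> filled_cantor J"
proof
  fix x assume "x \<in> S"
  then show "x \<in> filled_cantor J"
  proof (coinduction arbitrary: x rule: filled_cantor.coinduct)
    case (filled_cantor x)
    then consider "x \<in> J" | d y where "d \<in> digits" "y \<in> S" "y \<in> {0..1}" "x = branch d y"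
      using S by blast
    then show ?case
    proof cases
      case 2
      show ?thesis by (intro disjI2 exI[of _ y] exI[of _ d]) (use 2 in simp)
    qed simp
  qed
qed

lemma filled_cantor_mono: "J \<subseteq> J' \<Longrightarrow> filled_cantor J \<subseteq> filled_cantor J'"
  using filled_cantor_unfold[of J] by (intro filled_cantor_coinduct) blast

text \<open>The closure satisfies the same inclusion as the set itself, so by coinduction it is no larger.\<close>
lemma closed_filled_cantor:
  assumes J: "closed J" "J \<subseteq> {0..1}"
  shows "closed (filled_cantor J)"
proof -
  let ?X = "filled_cantor J"
  have bound: "closure ?X \<subseteq> {0..1}"
    using filled_cantor_subset[OF J(2)] by (simp add: closure_minimal)
  then have "compact (closure ?X)"
    by (meson bounded_closed_interval bounded_subset compact_eq_bounded_closed closed_closure)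
  then have "closed (branch d ` closure ?X)" for d
    by (intro compact_imp_closed compact_continuous_image continuous_intros)
  then have "closed (J \<union> (\<Union>d\<in>digits. branch d ` closure ?X))"
    using J(1) by (intro closed_Un closed_UN ballI) (auto simp: digits_def)
  moreover have "?X \<subseteq> J \<union> (\<Union>d\<in>digits. branch d ` closure ?X)"
    using closure_subset[of ?X] filled_cantor_unfold[of J] by blast
  ultimately have "closure ?X \<subseteq> J \<union> (\<Union>d\<in>digits. branch d ` closure ?X)"
    by (rule closure_minimal[rotated])
  then have "closure ?X \<subseteq> ?X"
    using Int_absorb2[OF bound] by (intro filled_cantor_coinduct) simp
  then show ?thesis by (simp add: closure_subset_eq)
qed

lemma endpoints_in_cantor: "0 \<in> filled_cantor {}" "1 \<in> filled_cantor {}"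
proof -
  show "0 \<in> filled_cantor {}"
    using filled_cantor_coinduct[of "{0}" "{}"] by (simp add: branch_def digits_def)
  show "1 \<in> filled_cantor {}"
    using filled_cantor_coinduct[of "{1}" "{}"] by (simp add: branch_def digits_def)
qed

lemma cantor_approximation:
  assumes S: "S \<noteq> {}" "\<And>d. d \<in> digits \<Longrightarrow> branch d ` S \<subseteq> S" "S \<subseteq> {0..1}"
    and J: "J \<subseteq> S"
  shows "filled_cantor J \<subseteq> closure S"
proof (rule contraction_approximation[where H = "branch ` digits" and c = "1/5"])
  have "filled_cantor J \<subseteq> {0..1}" using J S(3) by (intro filled_cantor_subset) auto
  then show "bounded (filled_cantor J)" by (metis bounded_closed_interval bounded_subset)
  show "bounded S" using S(3) by (metis bounded_closed_interval bounded_subset)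
  show "filled_cantor J \<subseteq> S \<union> (\<Union>h\<in>branch ` digits. h ` filled_cantor J)"
    using J filled_cantor_unfold[of J] by blast
qed (use S dist_branch in auto)

text \<open>The gap \<open>(3/5, 4/5)\<close> and all its copies stay empty, and these copies come arbitrarily close to
  every point of the Cantor set.\<close>
lemma interior_filled_cantor_Int_cantor:
  assumes J: "J \<subseteq> {1/5..2/5}"
  shows "filled_cantor {} \<inter> interior (filled_cantor J) = {}"
proof -
  let ?S = "{0<..<1} - filled_cantor J"
  have J01: "J \<subseteq> {0..1}" using J by force
  \<comment> \<open>The midpoint of the gap that is never filled.\<close>
  have "7/10 \<notin> filled_cantor J"
  proof
    assume "7/10 \<in> filled_cantor J"
    then show False using J by (cases rule: filled_cantor_cases) (auto simp: branch_def digits_def)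
  qed
  then have "7/10 \<in> ?S" by simp
  then have "?S \<noteq> {}" by blast
  \<comment> \<open>Only the endpoints of \<open>[0, 1]\<close> can be mapped into \<open>[1/5, 2/5]\<close> by a branch, which is why the
    set of outside points is taken in the open interval.\<close>
  moreover have "branch d ` ?S \<subseteq> ?S" if d: "d \<in> digits" for d
  proof safe
    fix x assume x: "x \<in> {0<..<1}" "x \<notin> filled_cantor J"
    then show "branch d x \<in> {0<..<1}" using d by (auto simp: branch_def digits_def)
    assume "branch d x \<in> filled_cantor J"
    then show False
    proof (cases rule: filled_cantor_cases)
      case 1
      then have "branch d x \<in> {1/5..2/5}" using J by blast
      then show False using x(1) d by (auto simp: branch_def digits_def)
    next
      case (2 e y)
      then have "x = y" using branch_eq_iff[of d x e y] x(1) d by auto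
      then show False using 2 x(2) by simp
    qed
  qed
  ultimately have "filled_cantor {} \<subseteq> closure ?S"
    by (intro cantor_approximation) auto
  moreover have "interior (filled_cantor J) \<inter> closure ?S = {}"
    using interior_subset by (subst open_Int_closure_eq_empty) auto
  ultimately show ?thesis by blast
qed

lemma cantor_set_cantor: "cantor_set (filled_cantor {})"
proof -
  let ?C = "filled_cantor {}"
  have C: "?C \<subseteq> {0..1}" by (rule filled_cantor_subset) simp
  have closed: "closed ?C" by (rule closed_filled_cantor) auto
  have near: "\<exists>y\<in>?C. y \<noteq> x \<and> dist y x \<le> (1/5) ^ n" if "x \<in> ?C" for x n
    using that
  proof (induction n arbitrary: x)
    case 0
    have "x \<in> {0..1}" using C 0 by blast
    then show ?case
      using endpoints_in_cantor by (cases "x = 0") (auto simp: dist_real_def)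
  next
    case (Suc n)
    from Suc.prems show ?case
    proof (cases rule: filled_cantor_cases)
      case (2 d x')
      obtain y where y: "y \<in> ?C" "y \<noteq> x'" "dist y x' \<le> (1/5) ^ n" using Suc.IH 2 by blast
      then have "branch d y \<in> ?C" using 2 C by (auto intro: branch)
      moreover have "branch d y \<noteq> x" using y 2 by (simp add: branch_def)
      moreover have "dist (branch d y) x \<le> (1/5) ^ Suc n" using y 2 by (simp add: dist_branch)
      ultimately show ?thesis by blast
    qed simp
  qed
  have "x islimpt ?C" if "x \<in> ?C" for x
    unfolding islimpt_approachable
  proof (intro allI impI)
    fix e :: real assume "0 < e"
    then obtain n where "(1/5) ^ n < e" using real_arch_pow_inv[of e "1/5"] by auto
    then show "\<exists>y\<in>?C. y \<noteq> x \<and> dist y x < e" using near[OF that, of n] by force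
  qed
  then have "perfect_set ?C" using closed by (simp add: perfect_set_def)
  moreover have "compact ?C"
    using closed C by (metis closed_Int_compact compact_Icc inf.absorb_iff1)
  moreover have "totally_disconnected ?C"
    unfolding totally_disconnected_def
  proof safe
    fix x y assume "connected_component ?C x y"
    then obtain T where T: "connected T" "T \<subseteq> ?C" "x \<in> T" "y \<in> T"
      by (auto simp: connected_component_def)
    have "\<not> u < v" if "u \<in> T" "v \<in> T" for u v
    proof
      assume "u < v"
      have "{u..v} \<subseteq> ?C" using connected_contains_Icc[OF T(1) that] T(2) by blast
      then have "{u<..<v} \<subseteq> interior ?C"
        by (intro interior_maximal) (auto intro: less_imp_le)
      moreover have "(u + v) / 2 \<in> {u<..<v}" using \<open>u < v\<close> by simp
      ultimately have "(u + v) / 2 \<in> ?C \<inter> interior ?C"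
        using interior_subset[of ?C] by blast
      then show False using interior_filled_cantor_Int_cantor[of "{}"] by simp
    qed
    then show "y = x" using T(3,4) by (meson linorder_neqE)
  qed (auto simp: connected_component_refl)
  ultimately show ?thesis using endpoints_in_cantor by (auto simp: cantor_set_def)
qed

text \<open>An affine branch preserves interiors, so a frontier point is either an end of the inserted
  interval or the image of a frontier point: coinduction applies with the two ends in place of the
  interval.\<close>
lemma frontier_filled_cantor_subset:
  assumes "{a..b} \<subseteq> {0..1}"
  shows "filled_cantor {a..b} - interior (filled_cantor {a..b}) \<subseteq> filled_cantor {a, b}"
proof (intro filled_cantor_coinduct subsetI)
  let ?X = "filled_cantor {a..b}"
  have int01: "interior ?X \<subseteq> {0..1}"
    using filled_cantor_subset[OF assms] interior_subset by blast
  fix x assume x: "x \<in> ?X - interior ?X"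
  then have "x \<in> ?X" by blast
  then show "x \<in> {a, b} \<union> (\<Union>d\<in>digits. branch d ` ((?X - interior ?X) \<inter> {0..1}))"
  proof (cases rule: filled_cantor_cases)
    case 1
    have "{a<..<b} \<subseteq> interior ?X"
      by (intro interior_maximal) (auto intro: fill)
    then show ?thesis using 1 x by force
  next
    case (2 d y)
    have "y \<notin> interior ?X"
    proof
      assume "y \<in> interior ?X"
      have "branch d ` interior ?X = (\<lambda>x. 5 * x - d) -` interior ?X"
      proof safe
        fix z assume "5 * z - d \<in> interior ?X"
        then have "branch d (5 * z - d) \<in> branch d ` interior ?X" by (rule imageI)
        then show "z \<in> branch d ` interior ?X" by simp
      qed simp
      moreover have "open ((\<lambda>x. 5 * x - d) -` interior ?X)"
        by (intro open_vimage) (auto intro!: continuous_intros)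
      moreover have "branch d ` interior ?X \<subseteq> ?X"
      proof
        fix z assume "z \<in> branch d ` interior ?X"
        then obtain w where "w \<in> interior ?X" "z = branch d w" by blast
        then show "z \<in> ?X" using int01 interior_subset 2(2) by (blast intro: branch)
      qed
      ultimately have "branch d ` interior ?X \<subseteq> interior ?X"
        by (intro interior_maximal) auto
      then show False using \<open>y \<in> interior ?X\<close> x 2(1) by blast
    qed
    then show ?thesis using 2 by blast
  qed
qed

text \<open>Isolated points inserted into the gaps cannot belong to any perfect subset. Since finitely many
  points have no limit point, a limit point of the whole set is the image under some branch of
  a limit point, and coinduction places it in the Cantor set.\<close>
lemma limit_points_filled_cantor:
  assumes F: "finite F" "F \<subseteq> {0..1}" and x: "x islimpt filled_cantor F"
  shows "x \<in> filled_cantor {}"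
proof -
  let ?X = "filled_cantor F"
  have X: "?X \<subseteq> {0..1}" by (rule filled_cantor_subset[OF F(2)])
  have closed: "closed ?X" using F by (intro closed_filled_cantor finite_imp_closed)
  have "{x. x islimpt ?X} \<subseteq> filled_cantor {}"
  proof (intro filled_cantor_coinduct subsetI)
    fix x assume "x \<in> {x. x islimpt ?X}"
    then have "x islimpt ?X" by simp
    moreover have "?X \<subseteq> F \<union> (\<Union>d\<in>digits. branch d ` ?X)"
      using filled_cantor_unfold[of F] by blast
    ultimately have "x islimpt F \<union> (branch 0 ` ?X \<union> branch 2 ` ?X \<union> branch 4 ` ?X)"
      by (elim islimpt_subset) (auto simp: digits_def)
    then obtain d where d: "d \<in> digits" "x islimpt branch d ` ?X"
      using F(1) by (auto simp: islimpt_Un islimpt_finite digits_def)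
    define y where "y = 5 * x - d"
    have y: "x = branch d y" by (simp add: y_def)
    have "(\<lambda>x. 5 * x - d) x islimpt (\<lambda>x. 5 * x - d) ` branch d ` ?X"
      using d(2) by (rule islimpt_injective_image) (auto intro!: continuous_intros inj_onI)
    then have "y islimpt ?X" by (simp add: y_def image_image)
    moreover have "y \<in> {0..1}" using \<open>y islimpt ?X\<close> X closed by (metis closed_limpt subsetD)
    ultimately show "x \<in> {} \<union> (\<Union>d\<in>digits. branch d ` ({x. x islimpt ?X} \<inter> {0..1}))"
      using y d(1) by blast
  qed
  then show ?thesis using x by blast
qed

section \<open>Generators that fill an interval\<close>

text \<open>These maps fill \<open>[a, b]\<close> without leaving any set \<open>X\<close> with \<open>[a, b] \<subseteq> X \<subseteq> [0, 1]\<close>, whatever the shape of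
  \<open>X\<close> outside the interval: \<open>push_left\<close> is the identity to the left of \<open>a\<close>, halves \<open>[a, b]\<close> towards \<open>a\<close>,
  and squeezes everything to the right of \<open>b\<close> into the other half of \<open>[a, b]\<close>. Each of its three summands
  contributes the increment over one of the three pieces. The mirror image \<open>push_right\<close> halves
  \<open>[a, b]\<close> towards \<open>b\<close>, and every point is sent into \<open>[a, b]\<close> by one of the two.\<close>
definition push_left :: "real \<Rightarrow> real \<Rightarrow> real \<Rightarrow> real" where
  "push_left a b x = min x a + (max a (min x b) - a) / 2 + (b - a) / (2 * (1 - b)) * (max x b - b)"

definition push_right :: "real \<Rightarrow> real \<Rightarrow> real \<Rightarrow> real" where
  "push_right a b x = 1 - push_left (1 - b) (1 - a) (1 - x)"

lemma push_left:
  assumes "0 \<le> a" "a < b" "b < 1"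
  shows "x \<le> a \<Longrightarrow> push_left a b x = x"
    and "\<lbrakk>a \<le> x; x \<le> b\<rbrakk> \<Longrightarrow> push_left a b x = (x + a) / 2"
    and "\<lbrakk>a \<le> x; x \<le> 1\<rbrakk> \<Longrightarrow> push_left a b x \<in> {a..b}"
    and "arc_map (push_left a b)"
proof -
  define s where "s = (b - a) / (2 * (1 - b))"
  have s: "0 < s" "s * (1 - b) = (b - a) / 2"
    using assms by (auto simp: s_def field_simps)
  have def: "push_left a b x = min x a + (max a (min x b) - a) / 2 + s * (max x b - b)" for x
    by (simp add: push_left_def s_def)
  show id: "push_left a b x = x" if "x \<le> a" for x using that assms by (simp add: def)
  show "push_left a b x = (x + a) / 2" if "a \<le> x" "x \<le> b" for x
    using that assms by (simp add: def field_simps)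
  show into: "push_left a b x \<in> {a..b}" if "a \<le> x" "x \<le> 1" for x
  proof -
    have "s * (max x b - b) \<le> s * (1 - b)"
      using s(1) that assms by (intro mult_left_mono) auto
    moreover have "0 \<le> s * (max x b - b)" using s(1) by simp
    moreover have "min x a = a" "a \<le> max a (min x b)" "max a (min x b) \<le> b"
      using that assms by auto
    ultimately have "a \<le> push_left a b x" "push_left a b x \<le> b"
      unfolding def using s(2) by argo+
    then show ?thesis by simp
  qed
  have "push_left a b x < push_left a b y" if "x < y" for x y
  proof -
    have "s * (max x b - b) \<le> s * (max y b - b)"
      using s(1) that by (intro mult_left_mono) auto
    moreover have "min x a \<le> min y a" "max a (min x b) \<le> max a (min y b)"
      using that by auto
    moreover consider "x < a" | "a \<le> x" "x < b" | "b \<le> x" by linarith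
    then have "min x a < min y a \<or> max a (min x b) < max a (min y b) \<or>
        s * (max x b - b) < s * (max y b - b)"
    proof cases
      case 3
      then show ?thesis using s(1) that by simp
    qed (use that assms in auto)
    ultimately show ?thesis unfolding def by argo
  qed
  moreover have "push_left a b x \<in> {0..1}" if "x \<in> {0..1}" for x
    using that id[of x] into[of x] assms by (cases "x \<le> a") auto
  moreover have "continuous_on {0..1} (push_left a b)"
    unfolding def by (intro continuous_intros) auto
  ultimately show "arc_map (push_left a b)"
    unfolding arc_map_def by (auto intro: strict_mono_onI)
qed

lemma arc_map_reflect:
  assumes "arc_map \<phi>"
  shows "arc_map (\<lambda>x. 1 - \<phi> (1 - x))"
  unfolding arc_map_def
proof (intro conjI)
  have \<phi>: "continuous_on {0..1} \<phi>" "strict_mono_on {0..1} \<phi>" "\<phi> ` {0..1} \<subseteq> {0..1}"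
    using assms by (auto simp: arc_map_def)
  show "continuous_on {0..1} (\<lambda>x. 1 - \<phi> (1 - x))"
    by (intro continuous_intros continuous_on_compose2[OF \<phi>(1)]) auto
  show "strict_mono_on {0..1} (\<lambda>x. 1 - \<phi> (1 - x))"
    using \<phi>(2) by (auto simp: strict_mono_on_def)
  show "(\<lambda>x. 1 - \<phi> (1 - x)) ` {0..1} \<subseteq> {0..1}"
    using \<phi>(3) by (auto simp: image_subset_iff)
qed

lemma push_right:
  assumes "0 < a" "a < b" "b \<le> 1"
  shows "b \<le> x \<Longrightarrow> push_right a b x = x"
    and "\<lbrakk>a \<le> x; x \<le> b\<rbrakk> \<Longrightarrow> push_right a b x = (x + b) / 2"
    and "\<lbrakk>0 \<le> x; x \<le> b\<rbrakk> \<Longrightarrow> push_right a b x \<in> {a..b}"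
    and "arc_map (push_right a b)"
proof -
  note L = push_left[of "1 - b" "1 - a"]
  show "b \<le> x \<Longrightarrow> push_right a b x = x"
    using L(1)[of "1 - x"] assms by (simp add: push_right_def)
  show "\<lbrakk>a \<le> x; x \<le> b\<rbrakk> \<Longrightarrow> push_right a b x = (x + b) / 2"
    using L(2)[of "1 - x"] assms by (simp add: push_right_def field_simps)
  show "\<lbrakk>0 \<le> x; x \<le> b\<rbrakk> \<Longrightarrow> push_right a b x \<in> {a..b}"
    using L(3)[of "1 - x"] assms by (auto simp: push_right_def)
  show "arc_map (push_right a b)"
    using arc_map_reflect[OF L(4)] assms unfolding push_right_def[abs_def] by simp
qed

lemma halving_invariant_interval:
  fixes a b :: real
  assumes S: "closed S" "S \<noteq> {}" "S \<subseteq> {a..b}"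
    and half: "\<And>x. x \<in> S \<Longrightarrow> (x + a) / 2 \<in> S" "\<And>x. x \<in> S \<Longrightarrow> (x + b) / 2 \<in> S"
  shows "{a..b} \<subseteq> S"
proof -
  let ?H = "{\<lambda>x. (x + a) / 2, \<lambda>x. (x + b) / 2}"
  have "{a..b} \<subseteq> closure S"
  proof (rule contraction_approximation[where H = ?H and c = "1/2"])
    show "{a..b} \<subseteq> S \<union> (\<Union>h\<in>?H. h ` {a..b})"
    proof
      fix x assume "x \<in> {a..b}"
      then have "2 * x - a \<in> {a..b} \<or> 2 * x - b \<in> {a..b}" by auto
      moreover have "x = ((2 * x - a) + a) / 2" "x = ((2 * x - b) + b) / 2" by auto
      ultimately show "x \<in> S \<union> (\<Union>h\<in>?H. h ` {a..b})" by blast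
    qed
    show "bounded S" using S(3) bounded_closed_interval bounded_subset by blast
    show "dist (h x) (h y) \<le> 1/2 * dist x y" if "h \<in> ?H" for h x y
    proof -
      have "h x - h y = (x - y) / 2" using that by (auto simp: field_simps)
      then show ?thesis by (simp only: dist_real_def abs_divide)
    qed
  qed (use S half in auto)
  then show ?thesis using S(1) by simp
qed

section \<open>The six descriptions\<close>

lemma realized_by_arc_maps:
  assumes \<phi>s: "\<phi>s \<noteq> []" "\<And>\<phi>. \<phi> \<in> set \<phi>s \<Longrightarrow> arc_map \<phi> \<and> \<phi> ` X \<subseteq> X"
    and X: "X \<noteq> {}" "closed X" "X \<subseteq> {0..1}"
    and min: "\<And>S. \<lbrakk>closed S; S \<noteq> {}; S \<subseteq> X; \<And>\<phi>. \<phi> \<in> set \<phi>s \<Longrightarrow> \<phi> ` S \<subseteq> S\<rbrakk> \<Longrightarrow> X \<subseteq> S"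
    and dec: "canonical_decomposition (hcis ` X) I K N" and P: "P (hcis ` X) I K N"
  shows "realized_as_minimal_set P"
proof -
  obtain fs where "fs \<noteq> []"
    "\<forall>f\<in>set fs. homeomorphic_map circle circle f \<and> has_rotation_number f 0"
    "minimal_set fs (hcis ` X)"
    using minimal_set_of_arc_maps[OF \<phi>s X min] by blast
  then show ?thesis using dec P unfolding realized_as_minimal_set_def by blast
qed

lemma arc_map_halve: "arc_map (\<lambda>x. x / 2)" "arc_map (\<lambda>x. (x + 1) / 2)"
  unfolding arc_map_def by (auto intro!: continuous_intros strict_mono_onI)

lemma realized_finite: "realized_as_minimal_set (\<lambda>M I K N. finite M)"
proof (rule realized_by_arc_maps[of "[\<lambda>x. x]" "{0}"])
  show "canonical_decomposition (hcis ` {0}) (hcis ` interior {0}) {} (hcis ` ({0} - interior {0}))"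
    by (rule canonical_decomposition_without_cantor_set) auto
qed (auto simp: arc_map_def intro: strict_mono_onI)

lemma realized_cantor: "realized_as_minimal_set (\<lambda>M I K N. cantor_set M)"
proof (rule realized_by_arc_maps[of "[branch 0, branch 2, branch 4]" "filled_cantor {}"])
  let ?C = "filled_cantor {}"
  show C01: "?C \<subseteq> {0..1}" by (rule filled_cantor_subset) simp
  show closed: "closed ?C" by (rule closed_filled_cantor) auto
  show "?C \<noteq> {}" using endpoints_in_cantor by blast
  show "arc_map \<phi> \<and> \<phi> ` ?C \<subseteq> ?C" if "\<phi> \<in> set [branch 0, branch 2, branch 4]" for \<phi>
  proof -
    have "\<phi> \<in> branch ` digits" using that by (auto simp: digits_def)
    then obtain d where d: "\<phi> = branch d" "d \<in> digits" by blast
    then show ?thesis using C01 arc_map_branch by (auto intro!: branch)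
  qed
  show "?C \<subseteq> S" if S: "closed S" "S \<noteq> {}" "S \<subseteq> ?C"
    "\<And>\<phi>. \<phi> \<in> set [branch 0, branch 2, branch 4] \<Longrightarrow> \<phi> ` S \<subseteq> S" for S
  proof -
    have "branch d ` S \<subseteq> S" if "d \<in> digits" for d
      using that by (intro S(4)) (auto simp: digits_def)
    then have "?C \<subseteq> closure S" using S C01 by (intro cantor_approximation) auto
    then show ?thesis using S(1) by simp
  qed
  have "interior ?C = {}"
    using interior_filled_cantor_Int_cantor[of "{}"] interior_subset[of ?C] by blast
  then show "canonical_decomposition (hcis ` ?C) (hcis ` interior ?C) (hcis ` ?C)
      (hcis ` (?C - interior ?C - ?C))"
    by (intro canonical_decomposition_with_cantor_set closed C01 cantor_set_cantor) auto
  show "cantor_set (hcis ` ?C)"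
    using C01 by (intro cantor_set_injective_image cantor_set_cantor inj_on_hcis continuous_intros)
qed simp

text \<open>The upper and the lower half circle each carry the two halving maps. A nonempty closed invariant set
  meets one of the half circles and hence contains it.\<close>
lemma realized_circle: "realized_as_minimal_set (\<lambda>M I K N. M = sphere 0 1)"
proof -
  have "\<exists>f. homeomorphic_map circle circle f \<and> has_rotation_number f 0 \<and>
      (\<forall>x\<in>{0..1}. f (hcis (x + t)) = hcis (\<phi> x + t))" if "arc_map \<phi>" for \<phi> t
    using circle_homeomorphism_of_arc_map[of \<phi> t] that unfolding arc_map_def by metis
  then obtain E where E: "\<And>\<phi> t. arc_map \<phi> \<Longrightarrow> homeomorphic_map circle circle (E \<phi> t)"
    "\<And>\<phi> t. arc_map \<phi> \<Longrightarrow> has_rotation_number (E \<phi> t) 0"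
    "\<And>\<phi> t x. \<lbrakk>arc_map \<phi>; x \<in> {0..1}\<rbrakk> \<Longrightarrow> E \<phi> t (hcis (x + t)) = hcis (\<phi> x + t)"
    by metis
  define fs where "fs = [E (\<lambda>x. x / 2) 0, E (\<lambda>x. (x + 1) / 2) 0, E (\<lambda>x. x / 2) 1, E (\<lambda>x. (x + 1) / 2) 1]"
  have homeo: "homeomorphic_map circle circle f \<and> has_rotation_number f 0" if "f \<in> set fs" for f
    using that E(1,2) arc_map_halve by (auto simp: fs_def)
  have "minimal_set fs (sphere 0 1)"
  proof (rule minimal_setI)
    show "invariant_set fs (sphere 0 1)"
      using homeo homeomorphic_imp_surjective_map by (fastforce simp: invariant_set_def)
    fix D assume D: "closed D" "D \<noteq> {}" "D \<subseteq> sphere 0 1" "invariant_set fs D"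
    define S where "S t = (\<lambda>x. hcis (x + t)) -` D \<inter> {0..1}" for t
    have full: "{0..1} \<subseteq> S t" if "S t \<noteq> {}" and t: "t \<in> {0, 1}" for t
    proof (rule halving_invariant_interval)
      show "closed (S t)"
        unfolding S_def using D(1) by (intro closed_Int closed_vimage continuous_intros) auto
      have "\<phi> x \<in> S t" if "x \<in> S t" "arc_map \<phi>" "E \<phi> t \<in> set fs" for \<phi> x
      proof -
        have "E \<phi> t (hcis (x + t)) \<in> D"
          using that D(4) by (auto simp: S_def invariant_set_def)
        moreover have "x \<in> {0..1}" using that by (simp add: S_def)
        moreover have "\<phi> x \<in> {0..1}"
          using \<open>arc_map \<phi>\<close> \<open>x \<in> {0..1}\<close> unfolding arc_map_def by blast
        ultimately show ?thesis using E(3)[OF \<open>arc_map \<phi>\<close>, of x t] by (simp add: S_def)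
      qed
      from this[of _ "\<lambda>x. x / 2"] this[of _ "\<lambda>x. (x + 1) / 2"]
      show "(x + 0) / 2 \<in> S t" "(x + 1) / 2 \<in> S t" if "x \<in> S t" for x
        using that arc_map_halve t by (auto simp: fs_def)
    qed (use that in \<open>auto simp: S_def\<close>)
    have 2: "hcis 2 = hcis 0" by (auto simp: hcis_eq_iff intro: exI[of _ 1])
    obtain z where "z \<in> D" using D(2) by blast
    then obtain y where y: "0 \<le> y" "y < 2" "hcis y \<in> D"
      using circle_eq_hcis[of z] D(3) by (metis subsetD)
    have "y \<in> S 0 \<or> y - 1 \<in> S 1" using y by (auto simp: S_def)
    \<comment> \<open>The two half circles share their endpoints, so filling one of them fills the other.\<close>
    moreover have "S 1 \<noteq> {}" if "S 0 \<noteq> {}"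
    proof -
      have "1 \<in> S 0" using full[OF that] by auto
      then have "0 \<in> S 1" by (simp add: S_def)
      then show ?thesis by blast
    qed
    moreover have "S 0 \<noteq> {}" if "S 1 \<noteq> {}"
    proof -
      have "1 \<in> S 1" using full[OF that] by auto
      then have "0 \<in> S 0" using 2 by (simp add: S_def)
      then show ?thesis by blast
    qed
    ultimately have S: "{0..1} \<subseteq> S 0" "{0..1} \<subseteq> S 1" using full by blast+
    show "sphere 0 1 \<subseteq> D"
    proof
      fix w :: complex assume "w \<in> sphere 0 1"
      then obtain x where x: "0 \<le> x" "x < 2" "w = hcis x" by (metis circle_eq_hcis)
      then have "x \<in> {0..1} \<or> x - 1 \<in> {0..1}" by auto
      then have "x \<in> S 0 \<or> x - 1 \<in> S 1" using S by blast
      then show "w \<in> D" using x by (auto simp: S_def)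
    qed
  qed (use homeo in auto)
  moreover have "circle interior_of (sphere 0 1) = sphere 0 1"
    by (metis interior_of_topspace topspace_euclidean_subtopology)
  then have "canonical_decomposition (sphere 0 1) (sphere 0 1) {} {}"
    by (auto simp: canonical_decomposition_def cantor_set_def)
  moreover have "fs \<noteq> []" by (simp add: fs_def)
  ultimately show ?thesis unfolding realized_as_minimal_set_def using homeo by metis
qed

lemma realized_interval:
  "realized_as_minimal_set (\<lambda>M I K N. M = I \<union> N \<and> I \<noteq> {} \<and> N \<noteq> {} \<and> K = {})"
proof (rule realized_by_arc_maps[of "[\<lambda>x. x / 2, \<lambda>x. (x + 1) / 2]" "{0..1}"])
  have diff: "{0..1} - interior {0..1} = {0, 1::real}" by auto
  show "canonical_decomposition (hcis ` {0..1}) (hcis ` interior {0..1}) {}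
      (hcis ` ({0..1} - interior {0..1}))"
    by (intro canonical_decomposition_without_cantor_set) (auto simp: diff)
  have "{0..1::real} = {0<..<1} \<union> {0, 1}" by auto
  then have "hcis ` {0..1} = hcis ` {0<..<1} \<union> hcis ` {0, 1}" by (metis image_Un)
  then show "hcis ` {0..1} = hcis ` interior {0..1} \<union> hcis ` ({0..1} - interior {0..1}) \<and>
      hcis ` interior {0..1} \<noteq> {} \<and> hcis ` ({0..1} - interior {0..1}) \<noteq> {} \<and> ({}::complex set) = {}"
    unfolding diff by simp
  show "{0..1} \<subseteq> S" if "closed S" "S \<noteq> {}" "S \<subseteq> {0..1}"
    "\<And>\<phi>. \<phi> \<in> set [\<lambda>x. x / 2, \<lambda>x. (x + 1) / 2] \<Longrightarrow> \<phi> ` S \<subseteq> S" for S :: "real set"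
    using that(1-3) that(4)[of "\<lambda>x. x / 2"] that(4)[of "\<lambda>x. (x + 1) / 2"]
    by (intro halving_invariant_interval) auto
qed (use arc_map_halve in \<open>auto simp: arc_map_def\<close>)

text \<open>The pushing maps send some point of a closed invariant subset into \<open>[a, b]\<close> and then fill this
  interval; the branches spread it over all its copies, which are dense in the whole set. For the
  decomposition, the frontier consists of the Cantor set and the ends of the copies, and these
  ends are isolated in the frontier unless they already lie in the Cantor set.\<close>
lemma realized_filled_cantor:
  assumes ab: "a < b" "1/5 \<le> a" "b \<le> 2/5"
  defines "X \<equiv> filled_cantor {a..b}" and "C \<equiv> filled_cantor {}"
  assumes P: "P (hcis ` X) (hcis ` interior X) (hcis ` C) (hcis ` (X - interior X - C))"
  shows "realized_as_minimal_set P"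
proof -
  let ?\<phi>s = "[branch 0, branch 2, branch 4, push_left a b, push_right a b]"
  have J: "{a..b} \<subseteq> {0..1}" "{a..b} \<subseteq> {1/5..2/5}" "{a, b} \<subseteq> {0..1}" using ab by auto
  have X01: "X \<subseteq> {0..1}" unfolding X_def by (rule filled_cantor_subset[OF J(1)])
  have closed: "closed X" unfolding X_def using J(1) by (intro closed_filled_cantor) auto
  have JX: "{a..b} \<subseteq> X" unfolding X_def by (auto intro: fill)
  have L: "push_left a b x = x" if "x \<le> a" for x using that ab by (intro push_left(1)) auto
  have L': "push_left a b x \<in> {a..b}" if "a \<le> x" "x \<le> 1" for x
    using that ab by (intro push_left(3)) auto
  have R: "push_right a b x = x" if "b \<le> x" for x using that ab by (intro push_right(1)) auto
  have R': "push_right a b x \<in> {a..b}" if "0 \<le> x" "x \<le> b" for x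
    using that ab by (intro push_right(3)) auto
  show ?thesis
  proof (rule realized_by_arc_maps[of ?\<phi>s X])
    show "arc_map \<phi> \<and> \<phi> ` X \<subseteq> X" if "\<phi> \<in> set ?\<phi>s" for \<phi>
    proof -
      have "\<phi> \<in> branch ` digits \<union> {push_left a b, push_right a b}"
        using that by (auto simp: digits_def)
      then consider d where "\<phi> = branch d" "d \<in> digits" | "\<phi> = push_left a b" | "\<phi> = push_right a b"
        by blast
      then show ?thesis
      proof cases
        case (1 d)
        then show ?thesis using X01 arc_map_branch by (auto intro!: branch simp: X_def)
      next
        case 2
        have "push_left a b x \<in> X" if "x \<in> X" for x
        proof (cases "x \<le> a")
          case False
          have "x \<in> {0..1}" using X01 that by blast
          then have "push_left a b x \<in> {a..b}" using L'[of x] False by simp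
          then show ?thesis using JX by blast
        qed (use that L in simp)
        then show ?thesis using 2 ab push_left(4)[of a b] by auto
      next
        case 3
        have "push_right a b x \<in> X" if "x \<in> X" for x
        proof (cases "b \<le> x")
          case False
          have "x \<in> {0..1}" using X01 that by blast
          then have "push_right a b x \<in> {a..b}" using R'[of x] False by simp
          then show ?thesis using JX by blast
        qed (use that R in simp)
        then show ?thesis using 3 ab push_right(4)[of a b] by auto
      qed
    qed
    show "X \<subseteq> S" if S: "closed S" "S \<noteq> {}" "S \<subseteq> X" "\<And>\<phi>. \<phi> \<in> set ?\<phi>s \<Longrightarrow> \<phi> ` S \<subseteq> S" for S
    proof -
      have pushS: "push_left a b x \<in> S" "push_right a b x \<in> S" if "x \<in> S" for x
        using S(4)[of "push_left a b"] S(4)[of "push_right a b"] that by auto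
      have "{a..b} \<subseteq> S \<inter> {a..b}"
      proof (rule halving_invariant_interval)
        obtain x where x: "x \<in> S" "0 \<le> x" "x \<le> 1" using S(2,3) X01 by fastforce
        show "S \<inter> {a..b} \<noteq> {}"
        proof (cases "a \<le> x")
          case True
          then show ?thesis using L'[of x] pushS(1) x by blast
        next
          case False
          then show ?thesis using R'[of x] pushS(2) x ab by force
        qed
        show "(x + a) / 2 \<in> S \<inter> {a..b}" if "x \<in> S \<inter> {a..b}" for x
          using that pushS(1)[of x] push_left(2)[of a b x] ab by auto
        show "(x + b) / 2 \<in> S \<inter> {a..b}" if "x \<in> S \<inter> {a..b}" for x
          using that pushS(2)[of x] push_right(2)[of a b x] ab by auto
      qed (use S(1) in auto)
      moreover have "branch d ` S \<subseteq> S" if "d \<in> digits" for d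
        using that by (intro S(4)) (auto simp: digits_def)
      ultimately have "X \<subseteq> closure S"
        unfolding X_def using S(2,3) X01 by (intro cantor_approximation) auto
      then show ?thesis using S(1) by simp
    qed
    show "canonical_decomposition (hcis ` X) (hcis ` interior X) (hcis ` C)
        (hcis ` (X - interior X - C))"
    proof (rule canonical_decomposition_with_cantor_set[OF closed X01])
      show "cantor_set C" unfolding C_def by (rule cantor_set_cantor)
      have "C \<subseteq> X" unfolding C_def X_def by (rule filled_cantor_mono) simp
      then show "C \<subseteq> X - interior X"
        using interior_filled_cantor_Int_cantor[OF J(2)] unfolding C_def X_def by blast
      fix D assume D: "cantor_set D" "D \<subseteq> X - interior X"
      show "D \<subseteq> C"
      proof
        fix x assume "x \<in> D"
        then have "x islimpt D" using D(1) by (simp add: cantor_set_def perfect_set_def)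
        moreover have "D \<subseteq> filled_cantor {a, b}"
          using D(2) frontier_filled_cantor_subset[OF J(1)] unfolding X_def by blast
        ultimately show "x \<in> C"
          unfolding C_def using limit_points_filled_cantor[of "{a, b}"] J(3)
          by (meson finite.emptyI finite.insertI islimpt_subset)
      qed
    qed
  qed (use ab JX closed X01 P in auto)
qed

lemma filled_cantor_gap: "\<lbrakk>x \<in> filled_cantor J; 1/5 < x; x < 2/5\<rbrakk> \<Longrightarrow> x \<in> J"
  by (erule filled_cantor_cases) (auto simp: branch_def digits_def)

text \<open>With \<open>[a, b]\<close> strictly inside the gap, the filled intervals do not touch the Cantor set, so that
  their endpoints form the countable part.\<close>
lemma realized_detached_intervals:
  "realized_as_minimal_set (\<lambda>M I K N.
     I \<noteq> {} \<and> K \<noteq> {} \<and> N \<noteq> {} \<and> (circle frontier_of I) \<inter> N \<noteq> {})"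
proof (rule realized_filled_cantor[of "1/4" "1/3"])
  let ?X = "filled_cantor {1/4..1/3}" and ?C = "filled_cantor {}"
  let ?I = "hcis ` interior ?X" and ?N = "hcis ` (?X - interior ?X - ?C)"
  have "{1/4<..<1/3} \<subseteq> interior ?X"
    by (intro interior_maximal) (auto intro: fill)
  have "1/4 \<notin> interior ?X"
  proof
    assume "1/4 \<in> interior ?X"
    then obtain e where e: "0 < e" "ball (1/4) e \<subseteq> ?X" by (auto simp: mem_interior)
    define y where "y = 1/4 - min (e/2) (1/40)"
    have y: "y < 1/4" "1/5 < y" "dist (1/4) y < e"
      using e(1) by (auto simp: y_def dist_real_def)
    then have "y \<in> ?X" using e(2) by auto
    then show False using filled_cantor_gap[of y "{1/4..1/3}"] y by auto
  qed
  moreover have "1/4 \<in> ?X" by (rule fill) simp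
  moreover have "1/4 \<notin> ?C" using filled_cantor_gap[of "1/4" "{}"] by auto
  ultimately have N: "hcis (1/4) \<in> ?N" by blast
  have X01: "?X \<subseteq> {0..1}" by (rule filled_cantor_subset) auto
  have "hcis ` closure {1/4<..<1/3} \<subseteq> closure ?I"
  proof (rule image_closure_subset)
    show "hcis ` {1/4<..<1/3} \<subseteq> closure ?I"
      using \<open>{1/4<..<1/3} \<subseteq> interior ?X\<close> closure_subset by blast
  qed (auto intro: continuous_intros)
  then have "hcis (1/4) \<in> closure ?I" by auto
  moreover have "?I \<subseteq> sphere 0 1" using hcis_in_circle by blast
  ultimately have "hcis (1/4) \<in> circle closure_of ?I"
    by (simp add: closure_of_subtopology Int_absorb1)
  moreover have "hcis (1/4) \<notin> ?I"
    using \<open>1/4 \<notin> interior ?X\<close> \<open>1/4 \<in> ?X\<close> X01 interior_subset[of ?X]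
    by (metis inj_on_hcis inj_on_image_mem_iff)
  then have "hcis (1/4) \<notin> circle interior_of ?I"
    using interior_of_subset by fastforce
  ultimately have "hcis (1/4) \<in> circle frontier_of ?I" by (simp add: frontier_of_def)
  moreover have "3/10 \<in> interior ?X"
    using \<open>{1/4<..<1/3} \<subseteq> interior ?X\<close> by (rule subsetD) auto
  ultimately show "?I \<noteq> {} \<and> hcis ` ?C \<noteq> {} \<and> ?N \<noteq> {} \<and> circle frontier_of ?I \<inter> ?N \<noteq> {}"
    using N endpoints_in_cantor by blast
qed auto

lemma filled_cantor_subset_cantor:
  assumes "F \<subseteq> (\<Union>d\<in>digits. branch d ` (filled_cantor F \<inter> {0..1}))"
  shows "filled_cantor F \<subseteq> filled_cantor {}"
  using assms filled_cantor_unfold[of F] by (intro filled_cantor_coinduct) blast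

text \<open>With \<open>[a, b]\<close> the whole closed gap, the ends of the filled intervals belong to the Cantor set and
  nothing countable is left over.\<close>
lemma realized_attached_intervals:
  "realized_as_minimal_set (\<lambda>M I K N. M = I \<union> K \<and> I \<noteq> {} \<and> K \<noteq> {} \<and> N = {})"
proof (rule realized_filled_cantor[of "1/5" "2/5"])
  let ?X = "filled_cantor {1/5..2/5}" and ?C = "filled_cantor {}"
  let ?F = "{1/5, 2/5::real}"
  have "?C \<subseteq> filled_cantor ?F" by (rule filled_cantor_mono) simp
  then have "0 \<in> filled_cantor ?F" "1 \<in> filled_cantor ?F" using endpoints_in_cantor by auto
  then have "branch 0 1 \<in> branch 0 ` (filled_cantor ?F \<inter> {0..1})"
    "branch 2 0 \<in> branch 2 ` (filled_cantor ?F \<inter> {0..1})"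
    by (intro imageI IntI; simp)+
  moreover have "branch 0 1 = 1/5" "branch 2 0 = 2/5" by (simp_all add: branch_def)
  moreover have "0 \<in> digits" "2 \<in> digits" by (simp_all add: digits_def)
  ultimately have "?F \<subseteq> (\<Union>d\<in>digits. branch d ` (filled_cantor ?F \<inter> {0..1}))"
    by (metis UN_I empty_subsetI insert_subset)
  then have "filled_cantor ?F \<subseteq> ?C" by (rule filled_cantor_subset_cantor)
  then have sub: "?X - interior ?X \<subseteq> ?C"
    using frontier_filled_cantor_subset[of "1/5" "2/5"] by auto
  have "?C \<subseteq> ?X" by (rule filled_cantor_mono) simp
  then have "?X = interior ?X \<union> ?C" using sub interior_subset by blast
  then have "hcis ` ?X = hcis ` interior ?X \<union> hcis ` ?C" by (metis image_Un)
  moreover have "{1/5<..<2/5} \<subseteq> interior ?X"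
    by (intro interior_maximal) (auto intro: fill)
  then have "3/10 \<in> interior ?X" by (rule subsetD) auto
  moreover have "?X - interior ?X - ?C = {}" using sub by blast
  ultimately show "hcis ` ?X = hcis ` interior ?X \<union> hcis ` ?C \<and> hcis ` interior ?X \<noteq> {} \<and>
      hcis ` ?C \<noteq> {} \<and> hcis ` (?X - interior ?X - ?C) = {}"
    using endpoints_in_cantor by blast
qed auto

theorem mainTheorem2:
  shows "realized_as_minimal_set (\<lambda>M I K N. finite M)
    \<and> realized_as_minimal_set (\<lambda>M I K N. cantor_set M)
    \<and> realized_as_minimal_set (\<lambda>M I K N. M = sphere 0 1)
    \<and> realized_as_minimal_set (\<lambda>M I K N.
         I \<noteq> {} \<and> K \<noteq> {} \<and> N \<noteq> {} \<and> (circle frontier_of I) \<inter> N \<noteq> {})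
    \<and> realized_as_minimal_set (\<lambda>M I K N.
         M = I \<union> N \<and> I \<noteq> {} \<and> N \<noteq> {} \<and> K = {})
    \<and> realized_as_minimal_set (\<lambda>M I K N.
         M = I \<union> K \<and> I \<noteq> {} \<and> K \<noteq> {} \<and> N = {})"
  by (intro conjI realized_finite realized_cantor realized_circle realized_detached_intervals
      realized_interval realized_attached_intervals)

end
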